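(* Let $d\ge 3$ and $n\ge d+1$. The vertex slice sequence of the cyclic polytope $C_d(n)$ is \[ VSS(C_d(n))=\begin{cases} \{1,2,\dots,2(n-2)\} & \text{if } d=3,\\ \{\,a\cdot b+i \;:\; a,b\in\{0,1,\dots,n-1\},\ i\in\{0,1,\dots,d\},\ a+b=n-i\,\} & \text{if } d>3. \end{cases} \]
   Context: The cyclic polytope $C_d(n)$ is the convex hull of $n$ points $\gamma(t_1),\dots,\gamma(t_n)$ on the moment curve $\gamma(t)=(t,t^2,\dots,t^d)\in\mathbb{R}^d$, where $t_1<\dots<t_n$ are real numbers. For a $d$-dimensional convex polytope $P\subset\mathbb{R}^d$, let $\mathcal{H}_P$ be the set of affine hyperplanes $H$ with $H\cap P\neq\emptyset$, and let $cv_P(H)=|V(H\cap P)|$ be the number of vertices of the slice $H\cap P$. The vertex slice sequence is the set of values $VSS(P)=cv_P(\mathcal{H}_P)$. *)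

theory Defs
  imports "HOL-Analysis.Analysis"
begin

(* The coordinates of real^'d are numbered 1, ..., CARD('d) along the linear order of 'd:
   the coordinate k has number card {..k}. *)
definition moment_curve :: "real \<Rightarrow> real ^ ('d::{finite,linorder})" where
  "moment_curve s = (\<chi> k. s ^ card {..k})"

(* The points on the curve have the parameters t 1, ..., t n; t is meant to be strictly
   increasing on {1..n}, its other values are irrelevant. *)
definition cyclic_polytope :: "nat \<Rightarrow> (nat \<Rightarrow> real) \<Rightarrow> (real ^ ('d::{finite,linorder})) set" where
  "cyclic_polytope n t = convex hull ((\<lambda>j. moment_curve (t j)) ` {1..n})"

definition affine_hyperplanes_meeting :: "'a::euclidean_space set \<Rightarrow> 'a set set" where
  "affine_hyperplanes_meeting P =
     {H. (\<exists>a b. a \<noteq> 0 \<and> H = {x. a \<bullet> x = b}) \<and> H \<inter> P \<noteq> {}}"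

definition vertices :: "'a::euclidean_space set \<Rightarrow> 'a set" where
  "vertices Q = {v. v extreme_point_of Q}"

definition slice_vertex_count :: "'a::euclidean_space set \<Rightarrow> 'a set \<Rightarrow> nat" where
  "slice_vertex_count P H = card (vertices (H \<inter> P))"

definition vertex_slice_sequence :: "'a::euclidean_space set \<Rightarrow> nat set" where
  "vertex_slice_sequence P = slice_vertex_count P ` affine_hyperplanes_meeting P"

end

theory Submission
  imports Defs "HOL-Computational_Algebra.Polynomial"
begin

text \<open>
  A hyperplane \<open>H\<close> sorts the vertices of a polytope \<open>P\<close> into those on \<open>H\<close>, those above and those
  below.  The vertices of the slice \<open>H \<inter> P\<close> are the vertices of \<open>P\<close> on \<open>H\<close> together with one point
  on each edge of \<open>P\<close> that joins a vertex above to a vertex below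
  (\<open>slice_vertex_count_convex_hull\<close>).  So a slice is counted by knowing the edges of \<open>P\<close> and the sign
  of an affine functional at each vertex.

  Restricted to the moment curve in dimension \<open>d\<close>, a nonconstant affine functional is a polynomial of
  degree between \<open>1\<close> and \<open>d\<close>, and every such polynomial arises.  The possible slices of the cyclic
  polytope are therefore governed by the sign vectors of these polynomials at \<open>t\<^sub>1 < \<dots> < t\<^sub>n\<close>, and
  polynomials that are nonnegative at all \<open>t\<^sub>i\<close> certify faces.

  If \<open>d \<ge> 4\<close>, the squares \<open>((x - t\<^sub>j)(x - t\<^sub>k))\<^sup>2\<close> show that every pair of vertices spans an edge.  With \<open>i\<close>
  vertices on the hyperplane and \<open>a\<close>, \<open>b\<close> on its two sides the slice has \<open>a b + i\<close> vertices; here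
  \<open>i \<le> d\<close> because a polynomial of degree at most \<open>d\<close> has at most \<open>d\<close> roots.  All such triples with
  a nonempty slice occur (\<open>sign_pattern_realizable\<close>): an odd number of consecutive roots separates the first \<open>a\<close> parameters
  from the later ones, and one further root at the very end \<open>t\<^sub>n\<close> does not disturb this.

  If \<open>d = 3\<close>, the edges are exactly the pairs that contain the first or the last vertex and the pairs of
  neighbours.  A vertex strictly between the first and the last one is thus joined to these two and to
  its neighbours, and a case distinction on the signs at the two ends bounds the number of vertices
  of a slice by \<open>2 (n - 2)\<close> (\<open>slice_number_le_dim3\<close>).  Quadratic polynomials that are positive on an
  interval of parameters and negative elsewhere give every value from \<open>3\<close> on, and slices through one
  or two vertices with all others on one side give \<open>1\<close> and \<open>2\<close>.
\<close>

section \<open>Vertices of a hyperplane slice of a polytope\<close>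

text \<open>
  The weights are those of the convex combination of \<open>u\<close> and \<open>w\<close> on which \<open>a\<close> takes the value \<open>b\<close>; they
  are positive as soon as \<open>a \<bullet> u > b > a \<bullet> w\<close>, the only case in which the point is used.
\<close>

definition crossing :: "'a::real_inner \<Rightarrow> real \<Rightarrow> 'a \<Rightarrow> 'a \<Rightarrow> 'a" where
  "crossing a b u w =
     ((a \<bullet> u - b) / (a \<bullet> u - a \<bullet> w)) *\<^sub>R w + ((b - a \<bullet> w) / (a \<bullet> u - a \<bullet> w)) *\<^sub>R u"

lemma crossing_on_hyperplane:
  assumes "a \<bullet> u > b" "a \<bullet> w < b"
  shows "a \<bullet> crossing a b u w = b"
proof -
  have "((a \<bullet> u - b) * (a \<bullet> w) + (b - a \<bullet> w) * (a \<bullet> u)) = b * (a \<bullet> u - a \<bullet> w)"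
    by (simp add: algebra_simps)
  then show ?thesis
    using assms by (simp add: crossing_def inner_add_right add_divide_distrib[symmetric])
qed

lemma crossing_in_open_segment:
  assumes "a \<bullet> u > b" "a \<bullet> w < b"
  shows "crossing a b u w \<in> open_segment u w"
proof -
  define s where "s = (a \<bullet> u - b) / (a \<bullet> u - a \<bullet> w)"
  have "1 - s = (b - a \<bullet> w) / (a \<bullet> u - a \<bullet> w)"
    using assms by (simp add: s_def field_simps)
  moreover have "0 < s" "s < 1" using assms by (simp_all add: s_def field_simps)
  moreover have "u \<noteq> w" using assms by auto
  ultimately show ?thesis
    unfolding in_segment by (auto simp: crossing_def s_def[symmetric] add.commute intro!: exI[of _ s])
qed

lemma segment_meets_hyperplane_only_in_crossing:
  assumes "a \<bullet> u > b" "a \<bullet> w < b" "x \<in> closed_segment u w" "a \<bullet> x = b"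
  shows "x = crossing a b u w"
proof -
  obtain s where s: "x = (1 - s) *\<^sub>R u + s *\<^sub>R w" using assms(3) unfolding in_segment by auto
  have "(1 - s) * (a \<bullet> u) + s * (a \<bullet> w) = b" using assms(4) s by (simp add: inner_add_right)
  then have "s * (a \<bullet> u - a \<bullet> w) = a \<bullet> u - b" by (simp add: algebra_simps)
  then have s1: "s = (a \<bullet> u - b) / (a \<bullet> u - a \<bullet> w)" using assms by (simp add: field_simps)
  have s2: "1 - s = (b - a \<bullet> w) / (a \<bullet> u - a \<bullet> w)"
    using assms by (simp add: s1 field_simps)
  show ?thesis unfolding crossing_def s1[symmetric] s2[symmetric] s by (simp add: add.commute)
qed

text \<open>
  Two families indexed by \<open>W\<close> and \<open>U\<close> are spread over the pairs: each \<open>h w\<close> is divided among the \<open>u\<close> in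
  proportion to \<open>p u\<close>, and each \<open>k u\<close> among the \<open>w\<close> in proportion to \<open>q w\<close>.  The shares add up to one.
\<close>

lemma balanced_double_sum:
  fixes h :: "'a \<Rightarrow> 'b::real_vector" and k :: "'c \<Rightarrow> 'b"
  assumes "sum p U = M" "sum q W = M" "M \<noteq> 0"
  shows "(\<Sum>u\<in>U. \<Sum>w\<in>W. (p u / M) *\<^sub>R h w + (q w / M) *\<^sub>R k u) = sum h W + sum k U"
proof -
  have "(\<Sum>u\<in>U. \<Sum>w\<in>W. (p u / M) *\<^sub>R h w) = (\<Sum>u\<in>U. p u / M) *\<^sub>R sum h W"
    by (simp add: scaleR_sum_right[symmetric] scaleR_sum_left)
  moreover have "(\<Sum>u\<in>U. \<Sum>w\<in>W. (q w / M) *\<^sub>R k u) = (\<Sum>w\<in>W. q w / M) *\<^sub>R sum k U"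
    by (simp add: scaleR_sum_right scaleR_sum_left sum.swap[of _ U W])
  moreover have "(\<Sum>u\<in>U. p u / M) = 1" "(\<Sum>w\<in>W. q w / M) = 1"
    using assms by (simp_all add: sum_divide_distrib[symmetric])
  ultimately show ?thesis by (simp add: sum.distrib)
qed

text \<open>
  Write \<open>x\<close> as a convex combination of \<open>S\<close> with coefficients \<open>c\<close>.  As \<open>x\<close> lies on the hyperplane, the
  points above and the points below contribute the same total height \<open>M\<close>.  Transporting height from
  each \<open>u\<close> above to each \<open>w\<close> below in proportion to their contributions regroups the combination into
  pairs, and each pair is in balance exactly at its crossing point.
\<close>

lemma convex_hull_slice:
  fixes S :: "'a::real_inner set"
  assumes fin: "finite S" and x: "x \<in> convex hull S" "a \<bullet> x = b"
  shows "x \<in> convex hull ({v \<in> S. a \<bullet> v = b} \<union>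
           {crossing a b u w | u w. u \<in> S \<and> w \<in> S \<and> a \<bullet> u > b \<and> a \<bullet> w < b})"
    (is "x \<in> convex hull (?Z \<union> ?C)")
proof -
  obtain c where c0: "\<And>v. v \<in> S \<Longrightarrow> c v \<ge> 0" and c1: "sum c S = 1"
    and cx: "(\<Sum>v\<in>S. c v *\<^sub>R v) = x"
    using x(1) unfolding convex_hull_finite[OF fin] by auto
  define U where "U = {v \<in> S. a \<bullet> v > b}"
  define W where "W = {v \<in> S. a \<bullet> v < b}"
  define p where "p v = c v * (a \<bullet> v - b)" for v
  define q where "q v = c v * (b - a \<bullet> v)" for v
  have finZ: "finite ?Z" "finite U" "finite W" using fin by (auto simp: U_def W_def)
  have S: "S = ?Z \<union> (U \<union> W)" by (auto simp: U_def W_def)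
  have dis: "U \<inter> W = {}" "?Z \<inter> (U \<union> W) = {}" by (auto simp: U_def W_def)
  have splitv: "sum g S = sum g ?Z + (sum g U + sum g W)" for g :: "'a \<Rightarrow> 'a"
    unfolding sum.union_disjoint[OF finZ(2,3) dis(1), symmetric]
      sum.union_disjoint[OF finZ(1) finite_UnI[OF finZ(2,3)] dis(2), symmetric] S[symmetric] ..
  have splitr: "sum g S = sum g ?Z + (sum g U + sum g W)" for g :: "'a \<Rightarrow> real"
    unfolding sum.union_disjoint[OF finZ(2,3) dis(1), symmetric]
      sum.union_disjoint[OF finZ(1) finite_UnI[OF finZ(2,3)] dis(2), symmetric] S[symmetric] ..
  have "sum p S = (\<Sum>v\<in>S. a \<bullet> (c v *\<^sub>R v)) - b * sum c S"
    by (simp add: p_def right_diff_distrib sum_subtractf sum_distrib_left mult.commute)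
  also have "\<dots> = a \<bullet> x - b" unfolding cx[symmetric] inner_sum_right c1 by simp
  also have "\<dots> = 0" using x(2) by simp
  finally have "sum p S = 0" .
  moreover have "sum p ?Z = 0" by (rule sum.neutral) (auto simp: p_def)
  moreover have "sum p W = - sum q W"
    by (simp add: p_def q_def sum_negf[symmetric] algebra_simps)
  ultimately have bal: "sum q W = sum p U" using splitr[of p] by simp
  show ?thesis
  proof (cases "sum p U = 0")
    case True
    have pU: "p u \<ge> 0" if "u \<in> U" for u using that c0[of u] by (simp add: p_def U_def)
    have qW: "q w \<ge> 0" if "w \<in> W" for w using that c0[of w] by (simp add: q_def W_def)
    have cU: "c u = 0" if "u \<in> U" for u
      using that True sum_nonneg_eq_0_iff[OF finZ(2) pU] by (auto simp: p_def U_def)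
    have cW: "c w = 0" if "w \<in> W" for w
      using that True bal sum_nonneg_eq_0_iff[OF finZ(3) qW] by (auto simp: q_def W_def)
    (* No mass lies off the hyperplane, so the combination uses only points on it. *)
    have "(\<Sum>v\<in>?Z. c v *\<^sub>R v) \<in> convex hull (?Z \<union> ?C)"
      using c1 splitr[of c] cU cW
      by (intro convex_sum) (auto simp: finZ c0 intro: hull_inc)
    then show ?thesis using cx splitv[of "\<lambda>v. c v *\<^sub>R v"] cU cW by simp
  next
    case False
    define M where "M = sum p U"
    have "M \<ge> 0" unfolding M_def by (rule sum_nonneg) (auto simp: p_def U_def c0)
    then have M: "M > 0" using False by (simp add: M_def)
    define l where "l = (\<lambda>(u, w). p u / M * c w + q w / M * c u)"
    define y where "y = (\<lambda>(u, w). crossing a b u w)"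
    have ly: "l (u, w) *\<^sub>R y (u, w) = (p u / M) *\<^sub>R (c w *\<^sub>R w) + (q w / M) *\<^sub>R (c u *\<^sub>R u)"
      if "u \<in> U" "w \<in> W" for u w
    proof -
      have ne: "a \<bullet> u - a \<bullet> w \<noteq> 0" using that by (auto simp: U_def W_def)
      have l: "l (u, w) = (c u * c w / M) * (a \<bullet> u - a \<bullet> w)"
        using M by (simp add: l_def p_def q_def field_simps)
      have "l (u, w) * ((a \<bullet> u - b) / (a \<bullet> u - a \<bullet> w)) = p u / M * c w"
        "l (u, w) * ((b - a \<bullet> w) / (a \<bullet> u - a \<bullet> w)) = q w / M * c u"
        unfolding l using ne M by (simp_all add: p_def q_def)
      then show ?thesis
        unfolding y_def crossing_def by (simp only: prod.case scaleR_right_distrib scaleR_scaleR)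
    qed
    have sum_l: "sum l (U \<times> W) = sum c W + sum c U"
      using balanced_double_sum[of p U M q W c c] bal M
      by (simp add: M_def sum.cartesian_product l_def)
    have "(\<Sum>e\<in>U\<times>W. l e *\<^sub>R y e) =
        (\<Sum>u\<in>U. \<Sum>w\<in>W. (p u / M) *\<^sub>R (c w *\<^sub>R w) + (q w / M) *\<^sub>R (c u *\<^sub>R u))"
      unfolding sum.cartesian_product by (rule sum.cong) (use ly in auto)
    also have "\<dots> = (\<Sum>w\<in>W. c w *\<^sub>R w) + (\<Sum>u\<in>U. c u *\<^sub>R u)"
      using bal M by (intro balanced_double_sum) (auto simp: M_def)
    finally have sum_ly: "(\<Sum>e\<in>U\<times>W. l e *\<^sub>R y e) = (\<Sum>w\<in>W. c w *\<^sub>R w) + (\<Sum>u\<in>U. c u *\<^sub>R u)" .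
    have l0: "l e \<ge> 0" if "e \<in> U \<times> W" for e
      using that M by (auto simp: l_def p_def q_def U_def W_def c0)
    (* The disjoint sum of the points on the hyperplane and of the pairs indexes one convex combination. *)
    let ?l = "case_sum c l" and ?y = "case_sum (\<lambda>v. v) y"
    have "(\<Sum>e\<in>?Z <+> U \<times> W. ?l e *\<^sub>R ?y e) \<in> convex hull (?Z \<union> ?C)"
    proof (rule convex_sum)
      show "sum ?l (?Z <+> U \<times> W) = 1"
        using finZ sum_l c1 splitr[of c] by (simp add: sum.Plus add.commute)
      fix e assume "e \<in> ?Z <+> U \<times> W"
      then show "?l e \<ge> 0" "?y e \<in> convex hull (?Z \<union> ?C)"
        using c0 l0 by (auto simp: y_def U_def W_def intro!: hull_inc)
    qed (auto simp: finZ)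
    moreover have "(\<Sum>e\<in>?Z <+> U \<times> W. ?l e *\<^sub>R ?y e) = x"
      using finZ sum_ly cx splitv[of "\<lambda>v. c v *\<^sub>R v"] by (simp add: sum.Plus o_def add.commute)
    ultimately show ?thesis by simp
  qed
qed

text \<open>
  By the previous lemma the slice is the convex hull of the points of \<open>S\<close> on the hyperplane and of all
  crossing points, and extreme points of a convex hull belong to the generating set.
\<close>

lemma extreme_point_of_slice_cases:
  fixes S :: "'a::real_inner set"
  assumes fin: "finite S" and x: "x extreme_point_of ({z. a \<bullet> z = b} \<inter> convex hull S)"
  obtains "x \<in> S" "a \<bullet> x = b"
  | u w where "u \<in> S" "w \<in> S" "a \<bullet> u > b" "a \<bullet> w < b" "x = crossing a b u w"
proof -
  let ?A = "{v \<in> S. a \<bullet> v = b} \<union> {crossing a b u w | u w. u \<in> S \<and> w \<in> S \<and> a \<bullet> u > b \<and> a \<bullet> w < b}"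
  have xH: "x \<in> convex hull S" "a \<bullet> x = b" using x by (auto simp: extreme_point_of_def)
  have "?A \<subseteq> {z. a \<bullet> z = b} \<inter> convex hull S"
  proof
    fix z assume "z \<in> ?A"
    then consider "z \<in> S" "a \<bullet> z = b"
      | u w where "u \<in> S" "w \<in> S" "a \<bullet> u > b" "a \<bullet> w < b" "z = crossing a b u w" by blast
    then show "z \<in> {z. a \<bullet> z = b} \<inter> convex hull S"
    proof cases
      case 1
      then show ?thesis by (simp add: hull_inc)
    next
      case 2
      have "open_segment u w \<subseteq> convex hull S"
        using closed_segment_subset[OF hull_inc hull_inc convex_convex_hull, OF 2(1,2)]
          segment_open_subset_closed by blast
      then show ?thesis
        using 2 crossing_on_hyperplane[of b a u w] crossing_in_open_segment[of b a u w] by auto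
    qed
  qed
  moreover have "convex ({z. a \<bullet> z = b} \<inter> convex hull S)"
    by (intro convex_Int convex_hyperplane convex_convex_hull)
  ultimately have "convex hull ?A \<subseteq> {z. a \<bullet> z = b} \<inter> convex hull S"
    by (rule hull_minimal)
  then have "x extreme_point_of (convex hull ?A)"
    using x convex_hull_slice[OF fin xH] unfolding extreme_point_of_def by blast
  then have "x \<in> ?A" by (rule extreme_point_of_convex_hull)
  then show ?thesis using that by blast
qed

definition feasible_directions :: "'a::real_vector set \<Rightarrow> 'a \<Rightarrow> 'a set" where
  "feasible_directions P x = {e. \<exists>\<epsilon>>0. x + \<epsilon> *\<^sub>R e \<in> P}"

lemma feasible_directions_add:
  assumes P: "convex P" and e: "e \<in> feasible_directions P x" and f: "f \<in> feasible_directions P x"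
  shows "e + f \<in> feasible_directions P x"
proof -
  obtain \<epsilon> \<delta> where ed: "\<epsilon> > 0" "x + \<epsilon> *\<^sub>R e \<in> P" "\<delta> > 0" "x + \<delta> *\<^sub>R f \<in> P"
    using e f by (auto simp: feasible_directions_def)
  define r where "r = \<delta> / (\<epsilon> + \<delta>)"
  have r: "0 \<le> r" "0 \<le> 1 - r" "1 - r = \<epsilon> / (\<epsilon> + \<delta>)" using ed by (auto simp: r_def field_simps)
  have "r *\<^sub>R (x + \<epsilon> *\<^sub>R e) + (1 - r) *\<^sub>R (x + \<delta> *\<^sub>R f) \<in> P"
    using P ed r by (intro convexD) auto
  also have "r *\<^sub>R (x + \<epsilon> *\<^sub>R e) + (1 - r) *\<^sub>R (x + \<delta> *\<^sub>R f) =
      x + (r * \<epsilon>) *\<^sub>R e + ((1 - r) * \<delta>) *\<^sub>R f"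
    by (simp add: algebra_simps)
  also have "\<dots> = x + (\<epsilon> * \<delta> / (\<epsilon> + \<delta>)) *\<^sub>R (e + f)"
    unfolding r(3) by (simp add: r_def scaleR_right_distrib mult.commute)
  finally show ?thesis
    using ed unfolding feasible_directions_def by (intro CollectI exI[of _ "\<epsilon> * \<delta> / (\<epsilon> + \<delta>)"]) auto
qed

lemma feasible_directions_scale:
  assumes "e \<in> feasible_directions P x" "c > 0"
  shows "c *\<^sub>R e \<in> feasible_directions P x"
proof -
  obtain \<epsilon> where "\<epsilon> > 0" "x + \<epsilon> *\<^sub>R e \<in> P" using assms by (auto simp: feasible_directions_def)
  then show ?thesis
    using assms(2) unfolding feasible_directions_def by (intro CollectI exI[of _ "\<epsilon> / c"]) auto
qed

text \<open>
  A direction that stays feasible at one point of \<open>P\<close> remains feasible at every point obtained from it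
  by moving towards some \<open>y \<in> P\<close> without reaching \<open>y\<close>: shrink the step by the factor \<open>\<theta>\<close>.
\<close>

lemma feasible_directions_transfer:
  assumes P: "convex P" and e: "e \<in> feasible_directions P z" and y: "y \<in> P"
    and x: "x = \<theta> *\<^sub>R z + (1 - \<theta>) *\<^sub>R y" "0 < \<theta>" "\<theta> \<le> 1"
  shows "e \<in> feasible_directions P x"
proof -
  obtain \<epsilon> where e: "\<epsilon> > 0" "z + \<epsilon> *\<^sub>R e \<in> P" using e by (auto simp: feasible_directions_def)
  have "\<theta> *\<^sub>R (z + \<epsilon> *\<^sub>R e) + (1 - \<theta>) *\<^sub>R y \<in> P"
    using P e y x by (intro convexD) auto
  also have "\<theta> *\<^sub>R (z + \<epsilon> *\<^sub>R e) + (1 - \<theta>) *\<^sub>R y = x + (\<theta> * \<epsilon>) *\<^sub>R e"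
    by (simp add: x(1) algebra_simps)
  finally show ?thesis
    using e x unfolding feasible_directions_def by (intro CollectI exI[of _ "\<theta> * \<epsilon>"]) auto
qed

lemma extreme_point_no_line:
  assumes "x extreme_point_of C" "e \<in> feasible_directions C x" "- e \<in> feasible_directions C x"
  shows "e = 0"
proof (rule ccontr)
  assume ne: "e \<noteq> 0"
  obtain \<epsilon> \<delta> where ed: "\<epsilon> > 0" "x + \<epsilon> *\<^sub>R e \<in> C" "\<delta> > 0" "x - \<delta> *\<^sub>R e \<in> C"
    using assms by (auto simp: feasible_directions_def)
  define r where "r = \<delta> / (\<epsilon> + \<delta>)"
  have "(\<epsilon> + \<delta>) *\<^sub>R e \<noteq> 0" using ne ed by auto
  then have "x - \<delta> *\<^sub>R e \<noteq> x + \<epsilon> *\<^sub>R e" by (auto simp: algebra_simps)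
  moreover have "0 < r" "r < 1" using ed by (auto simp: r_def field_simps)
  moreover have "(1 - r) *\<^sub>R (x - \<delta> *\<^sub>R e) + r *\<^sub>R (x + \<epsilon> *\<^sub>R e) = x + (r * (\<epsilon> + \<delta>) - \<delta>) *\<^sub>R e"
    by (simp add: algebra_simps)
  moreover have "r * (\<epsilon> + \<delta>) - \<delta> = 0" using ed by (simp add: r_def)
  ultimately have "x \<in> open_segment (x - \<delta> *\<^sub>R e) (x + \<epsilon> *\<^sub>R e)"
    unfolding in_segment by (intro conjI exI[of _ r]) auto
  then show False using assms(1) ed by (auto simp: extreme_point_of_def)
qed

text \<open>
  Among all segments between vertices only edges produce vertices of the slice.  If a point \<open>z\<close> of the
  segment \<open>[u, w]\<close> lies strictly between \<open>p\<close> and \<open>q\<close> in \<open>P\<close>, then at the crossing point \<open>x\<close> both the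
  directions \<open>\<plusminus>(q - p)\<close>, transferred from \<open>z\<close>, and \<open>\<plusminus>(w - u)\<close> are feasible.  A combination
  \<open>(q - p) + k (w - u)\<close> is parallel to the hyperplane, so it vanishes because \<open>x\<close> is extreme in the
  slice.  Hence \<open>p\<close> and \<open>q\<close> lie on the line through \<open>u\<close> and \<open>w\<close>, and between these two since they are
  extreme points of \<open>P\<close>.
\<close>

lemma face_through_extreme_crossing:
  fixes P :: "'a::real_inner set"
  assumes P: "convex P" and ext: "u extreme_point_of P" "w extreme_point_of P"
    and side: "a \<bullet> u > b" "a \<bullet> w < b"
    and x: "crossing a b u w extreme_point_of ({z. a \<bullet> z = b} \<inter> P)"
  shows "closed_segment u w face_of P"
proof -
  have uw: "u \<in> P" "w \<in> P" using ext by (auto simp: extreme_point_of_def)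
  let ?x = "crossing a b u w"
  obtain s where s: "0 < s" "s < 1" "?x = (1 - s) *\<^sub>R u + s *\<^sub>R w"
    using crossing_in_open_segment[OF side] unfolding in_segment by auto
  have along: "k *\<^sub>R (w - u) \<in> feasible_directions P ?x" for k
  proof -
    have "?x + (1 - s) *\<^sub>R (w - u) = w" "?x + s *\<^sub>R (u - w) = u"
      by (simp_all add: s(3) algebra_simps)
    then have d: "w - u \<in> feasible_directions P ?x" "u - w \<in> feasible_directions P ?x"
      using s uw unfolding feasible_directions_def by (metis (mono_tags, lifting) CollectI diff_gt_0_iff_gt)+
    show ?thesis
    proof (cases k "0::real" rule: linorder_cases)
      case less
      then show ?thesis
        using feasible_directions_scale[OF d(2), of "- k"] by (simp add: algebra_simps)
    next
      case equal
      then show ?thesis using x unfolding feasible_directions_def extreme_point_of_def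
        by (auto intro!: exI[of _ 1])
    next
      case greater
      then show ?thesis using feasible_directions_scale[OF d(1)] by simp
    qed
  qed
  have flat: "e = 0" if "a \<bullet> e = 0" "e \<in> feasible_directions P ?x" "- e \<in> feasible_directions P ?x" for e
  proof (rule extreme_point_no_line[OF x])
    show "e \<in> feasible_directions ({z. a \<bullet> z = b} \<inter> P) ?x"
      "- e \<in> feasible_directions ({z. a \<bullet> z = b} \<inter> P) ?x"
      using that crossing_on_hyperplane[OF side]
      by (auto simp: feasible_directions_def inner_add_right)
  qed
  have on_line: "p \<in> closed_segment u w" if "p \<in> P" "p = u + c *\<^sub>R (w - u)" for p c
  proof -
    have "u \<noteq> w" using side by auto
    consider "c < 0" | "c > 1" | "0 \<le> c" "c \<le> 1" by linarith
    then show ?thesis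
    proof cases
      case 1
      define r where "r = - c / (1 - c)"
      have "(1 - r) *\<^sub>R p + r *\<^sub>R w = u + (c - r * (c - 1)) *\<^sub>R (w - u)"
        by (simp add: that(2) algebra_simps)
      also have "c - r * (c - 1) = 0" using 1 by (simp add: r_def field_simps)
      finally have "u = (1 - r) *\<^sub>R p + r *\<^sub>R w" by simp
      moreover have "0 < r" "r < 1" using 1 by (simp_all add: r_def field_simps)
      moreover have "p \<noteq> w"
      proof
        assume "p = w"
        then have "(1 - c) *\<^sub>R (w - u) = 0"
          using that(2) by (simp add: scaleR_left_diff_distrib) (metis add_diff_cancel_left')
        then show False using 1 \<open>u \<noteq> w\<close> by simp
      qed
      ultimately have "u \<in> open_segment p w" unfolding in_segment by blast
      then show ?thesis using ext(1) uw that(1) by (auto simp: extreme_point_of_def)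
    next
      case 2
      define r where "r = 1 / c"
      have "(1 - r) *\<^sub>R u + r *\<^sub>R p = u + (r * c) *\<^sub>R (w - u)"
        by (simp add: that(2) algebra_simps)
      also have "r * c = 1" using 2 by (simp add: r_def)
      finally have "w = (1 - r) *\<^sub>R u + r *\<^sub>R p" by simp
      moreover have "0 < r" "r < 1" using 2 by (simp_all add: r_def field_simps)
      moreover have "u \<noteq> p" using 2 that(2) \<open>u \<noteq> w\<close> by auto
      ultimately have "w \<in> open_segment u p" unfolding in_segment by blast
      then show ?thesis using ext(2) uw that(1) by (auto simp: extreme_point_of_def)
    next
      case 3
      then show ?thesis unfolding in_segment using that(2)
        by (intro exI[of _ c]) (simp add: algebra_simps)
    qed
  qed
  show ?thesis
    unfolding face_of_def
  proof (intro conjI ballI impI)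
    show "closed_segment u w \<subseteq> P" using uw P by (rule closed_segment_subset)
    fix p q z assume pq: "p \<in> P" "q \<in> P" and z: "z \<in> closed_segment u w" "z \<in> open_segment p q"
    obtain r where r: "0 \<le> r" "r \<le> 1" "z = (1 - r) *\<^sub>R u + r *\<^sub>R w"
      using z(1) unfolding in_segment by auto
    obtain t where t: "0 < t" "t < 1" "z = (1 - t) *\<^sub>R p + t *\<^sub>R q"
      using z(2) unfolding in_segment by auto
    define d where "d = q - p"
    have p: "p = z - t *\<^sub>R d" and q: "q = z + (1 - t) *\<^sub>R d" by (simp_all add: t(3) d_def algebra_simps)
    have "d \<in> feasible_directions P z" unfolding feasible_directions_def
      using t pq q by (auto intro!: exI[of _ "1 - t"])
    moreover have "- d \<in> feasible_directions P z" unfolding feasible_directions_def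
      using t pq p by (auto intro!: exI[of _ t])
    (* Seen from z, the crossing point lies towards w or towards u, according to their order on [u, w]. *)
    moreover obtain \<theta> y where "0 < \<theta>" "\<theta> \<le> 1" "y \<in> P" "?x = \<theta> *\<^sub>R z + (1 - \<theta>) *\<^sub>R y"
    proof (cases "r \<le> s")
      case True
      define \<theta> where "\<theta> = (1 - s) / (1 - r)"
      have "\<theta> *\<^sub>R z + (1 - \<theta>) *\<^sub>R w = w + (\<theta> * (1 - r)) *\<^sub>R (u - w)"
        by (simp add: r(3) algebra_simps)
      also have "\<theta> * (1 - r) = 1 - s" using True s by (simp add: \<theta>_def)
      also have "w + (1 - s) *\<^sub>R (u - w) = ?x" by (simp add: s(3) algebra_simps)
      finally show ?thesis using that[of \<theta> w] True s uw by (simp add: \<theta>_def)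
    next
      case False
      define \<theta> where "\<theta> = s / r"
      have "\<theta> *\<^sub>R z + (1 - \<theta>) *\<^sub>R u = u + (\<theta> * r) *\<^sub>R (w - u)"
        by (simp add: r(3) algebra_simps)
      also have "\<theta> * r = s" using False s by (simp add: \<theta>_def)
      also have "u + s *\<^sub>R (w - u) = ?x" by (simp add: s(3) algebra_simps)
      finally show ?thesis using that[of \<theta> u] False s uw by (simp add: \<theta>_def)
    qed
    ultimately have d: "d \<in> feasible_directions P ?x" "- d \<in> feasible_directions P ?x"
      using feasible_directions_transfer[OF P] by blast+
    define k where "k = (a \<bullet> d) / (a \<bullet> u - a \<bullet> w)"
    have "a \<bullet> (d + k *\<^sub>R (w - u)) = 0"
    proof -
      have "k * (a \<bullet> u - a \<bullet> w) = a \<bullet> d" using side by (simp add: k_def)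
      then show ?thesis by (simp add: inner_add_right inner_diff_right algebra_simps)
    qed
    moreover have "- (d + k *\<^sub>R (w - u)) = - d + (- k) *\<^sub>R (w - u)" by (simp add: algebra_simps)
    ultimately have "d + k *\<^sub>R (w - u) = 0"
      using flat[of "d + k *\<^sub>R (w - u)"] feasible_directions_add[OF P d(1) along]
        feasible_directions_add[OF P d(2) along] by metis
    then have dk: "d = (- k) *\<^sub>R (w - u)" by (simp add: add_eq_0_iff2)
    have "p = u + (r + t * k) *\<^sub>R (w - u)" "q = u + (r - (1 - t) * k) *\<^sub>R (w - u)"
      unfolding p q r(3) dk by (simp_all add: algebra_simps)
    then show "p \<in> closed_segment u w" "q \<in> closed_segment u w" using on_line pq by blast+
  qed auto
qed

text \<open>
  Cutting a face of \<open>P\<close> by the hyperplane gives a face of the slice, and the hyperplane cuts the edge in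
  a single point.
\<close>

lemma edge_crossing_is_extreme:
  fixes P :: "'a::real_inner set"
  assumes F: "closed_segment u w face_of P" and side: "a \<bullet> u > b" "a \<bullet> w < b"
  shows "crossing a b u w extreme_point_of ({z. a \<bullet> z = b} \<inter> P)"
proof -
  have "closed_segment u w \<inter> {z. a \<bullet> z = b} face_of P \<inter> {z. a \<bullet> z = b}"
    by (rule face_of_slice[OF F convex_hyperplane])
  moreover have "closed_segment u w \<inter> {z. a \<bullet> z = b} = {crossing a b u w}"
    using segment_meets_hyperplane_only_in_crossing[OF side] crossing_in_open_segment[OF side]
      crossing_on_hyperplane[OF side] segment_open_subset_closed by blast
  ultimately show ?thesis by (simp add: face_of_singleton Int_commute)
qed

text \<open>
  Different edges cross the hyperplane in different points, as an edge contains the ends of every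
  segment of \<open>P\<close> that it meets in an inner point.
\<close>

lemma edge_determined_by_inner_point:
  assumes F: "closed_segment u' w' face_of P" and ext: "u extreme_point_of P" "w extreme_point_of P"
    and x: "x \<in> open_segment u w" "x \<in> closed_segment u' w'"
  shows "u \<in> {u', w'} \<and> w \<in> {u', w'}"
proof -
  have "u \<in> P" "w \<in> P" using ext by (auto simp: extreme_point_of_def)
  then have "u \<in> closed_segment u' w'" "w \<in> closed_segment u' w'"
    using face_ofD[OF F x(1) _ _ x(2)] by auto
  then have "u extreme_point_of closed_segment u' w'" "w extreme_point_of closed_segment u' w'"
    using ext by (simp_all add: extreme_point_of_face[OF F])
  then show ?thesis unfolding segment_convex_hull by (blast dest: extreme_point_of_convex_hull)
qed

proposition slice_vertex_count_convex_hull: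
  fixes S :: "'a::euclidean_space set"
  assumes fin: "finite S" and ext: "\<And>v. v \<in> S \<Longrightarrow> v extreme_point_of (convex hull S)"
  shows "slice_vertex_count (convex hull S) {z. a \<bullet> z = b} =
     card {v \<in> S. a \<bullet> v = b} +
     card {(u, w) \<in> S \<times> S. a \<bullet> u > b \<and> a \<bullet> w < b \<and> closed_segment u w face_of (convex hull S)}"
    (is "_ = card ?Z + card ?E")
proof -
  let ?P = "convex hull S" and ?c = "\<lambda>(u, w). crossing a b u w"
  have "vertices ({z. a \<bullet> z = b} \<inter> ?P) = ?Z \<union> ?c ` ?E"
  proof (intro set_eqI iffI)
    fix x assume x: "x \<in> vertices ({z. a \<bullet> z = b} \<inter> ?P)"
    then have x: "x extreme_point_of ({z. a \<bullet> z = b} \<inter> ?P)" by (simp add: vertices_def)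
    show "x \<in> ?Z \<union> ?c ` ?E"
    proof (rule extreme_point_of_slice_cases[OF fin x])
      fix u w assume uw: "u \<in> S" "w \<in> S" "a \<bullet> u > b" "a \<bullet> w < b" "x = crossing a b u w"
      then have "closed_segment u w face_of ?P"
        using x by (intro face_through_extreme_crossing[of _ _ _ b a] ext convex_convex_hull) auto
      then show ?thesis using uw by force
    qed auto
  next
    fix x assume "x \<in> ?Z \<union> ?c ` ?E"
    then consider "x \<in> S" "a \<bullet> x = b"
      | u w where "(u, w) \<in> ?E" "x = crossing a b u w" by auto
    then show "x \<in> vertices ({z. a \<bullet> z = b} \<inter> ?P)"
    proof cases
      case 1
      then show ?thesis
        using ext[of x] by (auto simp: vertices_def extreme_point_of_def)
    next
      case 2
      then show ?thesis using edge_crossing_is_extreme[of u w ?P b a] by (auto simp: vertices_def)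
    qed
  qed
  moreover have "?Z \<inter> ?c ` ?E = {}"
  proof -
    have "\<not> crossing a b u w extreme_point_of ?P" if "(u, w) \<in> ?E" for u w
    proof -
      have "crossing a b u w \<in> open_segment u w" using that by (intro crossing_in_open_segment) auto
      moreover have "u \<in> ?P" "w \<in> ?P" using that by (auto intro: hull_inc)
      ultimately show ?thesis unfolding extreme_point_of_def by blast
    qed
    moreover have "x extreme_point_of ?P" if "x \<in> ?Z" for x using ext that by simp
    ultimately show ?thesis by fast
  qed
  moreover have "inj_on ?c ?E"
  proof (rule inj_onI, clarify)
    fix u w u' w'
    assume *: "u \<in> S" "w \<in> S" "b < a \<bullet> u" "a \<bullet> w < b"
      "u' \<in> S" "w' \<in> S" "b < a \<bullet> u'" "a \<bullet> w' < b" "closed_segment u' w' face_of ?P"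
      "crossing a b u w = crossing a b u' w'"
    have "crossing a b u w \<in> closed_segment u' w'"
      unfolding *(10) using crossing_in_open_segment[OF *(7,8)] segment_open_subset_closed by blast
    then have "u \<in> {u', w'} \<and> w \<in> {u', w'}"
      by (rule edge_determined_by_inner_point[OF *(9) ext[OF *(1)] ext[OF *(2)]
            crossing_in_open_segment[OF *(3,4)]])
    then show "u = u' \<and> w = w'" using * by auto
  qed
  moreover have "finite ?Z" using fin by simp
  moreover have "finite ?E"
    by (rule finite_subset[of _ "S \<times> S"]) (use fin in auto)
  ultimately show ?thesis
    unfolding slice_vertex_count_def by (simp add: card_Un_disjoint card_image)
qed

section \<open>Affine functionals on the moment curve\<close>

text \<open>
  The exponents \<open>card {..k}\<close> of the moment curve run through \<open>1, \<dots>, d\<close>, each once, so that coordinates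
  may be renamed to exponents.
\<close>

lemma bij_betw_coordinate_number:
  "bij_betw (\<lambda>k::'d::{finite,linorder}. card {..k}) UNIV {1..CARD('d)}"
proof -
  have "strict_mono (\<lambda>k::'d. card {..k})"
    by (rule strict_monoI) (intro psubset_card_mono, auto)
  then have inj: "inj (\<lambda>k::'d. card {..k})" by (rule strict_mono_imp_inj_on)
  moreover have "range (\<lambda>k::'d. card {..k}) = {1..CARD('d)}"
  proof (rule card_subset_eq)
    show "range (\<lambda>k::'d. card {..k}) \<subseteq> {1..CARD('d)}"
    proof safe
      fix k :: 'd
      have "card {..k} > 0" by (simp add: card_gt_0_iff)
      moreover have "card {..k} \<le> CARD('d)" by (rule card_mono) auto
      ultimately show "card {..k} \<in> {1..CARD('d)}" by simp
    qed
    show "card (range (\<lambda>k::'d. card {..k})) = card {1..CARD('d)}"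
      using inj by (simp add: card_image)
  qed simp
  ultimately show ?thesis by (simp add: bij_betw_def)
qed

lemma inner_moment_curve:
  fixes a :: "real ^ 'd::{finite,linorder}"
  assumes "\<And>k. a $ k = c (card {..k})"
  shows "a \<bullet> moment_curve s = (\<Sum>i=1..CARD('d). c i * s ^ i)"
proof -
  have "a \<bullet> moment_curve s = (\<Sum>k\<in>UNIV. c (card {..k::'d}) * s ^ card {..k})"
    by (simp add: inner_vec_def moment_curve_def assms)
  also have "\<dots> = (\<Sum>i=1..CARD('d). c i * s ^ i)"
    by (rule sum.reindex_bij_betw[OF bij_betw_coordinate_number])
  finally show ?thesis .
qed

text \<open>
  The coefficients of positive index become the normal vector, which is nonzero because the degree is
  positive; the constant coefficient becomes the offset.
\<close>

lemma affine_functional_of_poly: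
  assumes "degree p \<le> CARD('d::{finite,linorder})" "degree p \<ge> 1"
  obtains a :: "real ^ 'd::{finite,linorder}" and b where "a \<noteq> 0" "\<And>s. a \<bullet> moment_curve s - b = poly p s"
proof
  let ?a = "(\<chi> k. coeff p (card {..k})) :: real ^ 'd::{finite,linorder}"
  have "degree p \<in> range (\<lambda>k::'d. card {..k})"
    using assms bij_betw_coordinate_number[where 'd='d] by (simp add: bij_betw_def)
  then obtain k :: 'd where "degree p = card {..k}" by auto
  then have "?a $ k = lead_coeff p" by simp
  then show "?a \<noteq> 0" using assms(2) by (metis degree_0 leading_coeff_0_iff not_one_le_zero zero_index)
  fix s
  have "poly p s = (\<Sum>i\<le>CARD('d). coeff p i * s ^ i)"
    unfolding poly_altdef by (rule sum.mono_neutral_left) (use assms in \<open>auto simp: coeff_eq_0\<close>)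
  also have "{..CARD('d)} = insert 0 {1..CARD('d)}" by auto
  finally have "poly p s = coeff p 0 + (\<Sum>i=1..CARD('d). coeff p i * s ^ i)" by simp
  then show "?a \<bullet> moment_curve s - (- coeff p 0) = poly p s"
    by (simp add: inner_moment_curve[where c="coeff p"])
qed

lemma poly_of_affine_functional:
  fixes a :: "real ^ 'd::{finite,linorder}"
  assumes "a \<noteq> 0"
  obtains p where "degree p \<ge> 1" "degree p \<le> CARD('d)" "\<And>s. poly p s = a \<bullet> moment_curve s - b"
proof -
  define f where "f = the_inv (\<lambda>k::'d. card {..k})"
  have inj: "inj (\<lambda>k::'d. card {..k})" using bij_betw_coordinate_number by (auto simp: bij_betw_def)
  have f: "f (card {..k}) = k" for k by (simp add: f_def the_inv_f_f[OF inj])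
  define p where "p = (\<Sum>i=1..CARD('d). monom (a $ f i) i) - [:b:]"
  obtain k where k: "a $ k \<noteq> 0" using assms by (auto simp: vec_eq_iff)
  have kr: "card {..k} \<in> {1..CARD('d)}" using bij_betw_coordinate_number by (auto simp: bij_betw_def)
  have "coeff p (card {..k}) = (\<Sum>i=1..CARD('d). if i = card {..k} then a $ f i else 0)"
    using kr by (simp add: p_def coeff_sum coeff_pCons split: nat.split)
  also have "\<dots> = a $ k" using kr f by simp
  finally have "card {..k} \<le> degree p" using k by (intro le_degree) simp
  then have "degree p \<ge> 1" using kr by simp
  moreover have "degree p \<le> CARD('d)"
    unfolding p_def
    by (intro degree_diff_le degree_sum_le) (auto intro: order_trans[OF degree_monom_le])
  moreover have "poly p s = a \<bullet> moment_curve s - b" for s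
    using inner_moment_curve[of a "\<lambda>i. a $ f i" s] by (simp add: f p_def poly_sum poly_monom)
  ultimately show ?thesis using that by blast
qed

text \<open>
  The supporting hyperplane cuts out a face, and a face of a convex hull of finitely many points is
  spanned by those among them that it contains.
\<close>

lemma face_of_convex_hull_Int_hyperplane:
  fixes S :: "'a::euclidean_space set"
  assumes fin: "finite S" and ge: "\<And>v. v \<in> S \<Longrightarrow> a \<bullet> v \<ge> b"
  shows "convex hull {v \<in> S. a \<bullet> v = b} face_of convex hull S"
proof -
  let ?F = "convex hull S \<inter> {z. a \<bullet> z = b}"
  have "convex hull S \<subseteq> {z. a \<bullet> z \<ge> b}"
    by (rule hull_minimal) (use ge in \<open>auto simp: convex_halfspace_ge\<close>)
  then have F: "?F face_of convex hull S"
    by (intro face_of_Int_supporting_hyperplane_ge) auto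
  then obtain T where T: "T \<subseteq> S" "?F = convex hull T"
    using face_of_convex_hull_subset[OF finite_imp_compact[OF fin]] by blast
  have "T \<subseteq> {v \<in> S. a \<bullet> v = b}" using T hull_subset[of T convex] by blast
  then have "?F \<subseteq> convex hull {v \<in> S. a \<bullet> v = b}" unfolding T(2) by (rule hull_mono)
  moreover have "convex hull {v \<in> S. a \<bullet> v = b} \<subseteq> ?F"
    by (rule hull_minimal) (auto intro: hull_inc convex_Int convex_hyperplane)
  ultimately show ?thesis using F by simp
qed

lemma inj_moment_curve: "inj (moment_curve :: real \<Rightarrow> real ^ 'd::{finite,linorder})"
proof (rule injI)
  fix x y :: real assume eq: "(moment_curve x :: real ^ 'd::{finite,linorder}) = moment_curve y"
  obtain k :: 'd where "card {..k} = 1"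
    using bij_betw_coordinate_number[where 'd='d] by (fastforce simp: bij_betw_def image_iff set_eq_iff)
  then show "x = y" using arg_cong[OF eq, of "\<lambda>v. v $ k"] by (simp add: moment_curve_def)
qed

lemma poly_linear_factor: "poly [:- c, 1:] x = x - c" "poly [:c, - 1:] x = c - x"
  for c x :: real
  by simp_all

section \<open>From hyperplanes to polynomials\<close>

text \<open>
  The vertex map \<open>v\<close> is a parameter because its type is what ties the dimension \<open>'d\<close> to the locale.
\<close>

locale cyclic =
  fixes n :: nat and t :: "nat \<Rightarrow> real" and v :: "nat \<Rightarrow> real ^ 'd::{finite,linorder}"
  assumes dim: "CARD('d) \<ge> 3" and size: "n \<ge> CARD('d) + 1"
    and mono: "strict_mono_on {1..n} t"
    and v_def: "v = (\<lambda>j. moment_curve (t j))"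
begin

abbreviation "P \<equiv> cyclic_polytope n t :: (real ^ 'd::{finite,linorder}) set"

lemma P_eq: "P = convex hull (v ` {1..n})" by (simp add: cyclic_polytope_def v_def)

lemma t_less_iff: "j \<in> {1..n} \<Longrightarrow> k \<in> {1..n} \<Longrightarrow> t j < t k \<longleftrightarrow> j < k"
  using mono by (rule strict_mono_on_less)

lemma t_le_iff: "j \<in> {1..n} \<Longrightarrow> k \<in> {1..n} \<Longrightarrow> t j \<le> t k \<longleftrightarrow> j \<le> k"
  using mono by (rule strict_mono_on_less_eq)

lemma t_eq_iff: "j \<in> {1..n} \<Longrightarrow> k \<in> {1..n} \<Longrightarrow> t j = t k \<longleftrightarrow> j = k"
  using t_less_iff[of j k] t_less_iff[of k j] by (metis less_irrefl linorder_neqE_nat)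

lemma inj_v: "inj_on v {1..n}"
proof (rule inj_onI)
  fix j k assume jk: "j \<in> {1..n}" "k \<in> {1..n}" and "v j = v k"
  then have "t j = t k" using injD[OF inj_moment_curve] by (simp add: v_def)
  then show "j = k" using t_eq_iff[OF jk] by simp
qed

text \<open>
  Gale's method: a polynomial that is nonnegative at all parameters is a supporting hyperplane of the
  cyclic polytope, and its roots among the parameters are the vertices of the supported face.
\<close>

lemma face_of_nonneg_poly:
  assumes "degree p \<le> CARD('d)" "degree p \<ge> 1" "J \<subseteq> {1..n}"
    and pos: "\<And>i. i \<in> {1..n} \<Longrightarrow> poly p (t i) \<ge> 0"
    and zero: "\<And>i. i \<in> {1..n} \<Longrightarrow> poly p (t i) = 0 \<longleftrightarrow> i \<in> J"
  shows "convex hull (v ` J) face_of P"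
proof -
  obtain a :: "real ^ 'd::{finite,linorder}" and b where ab: "\<And>s. a \<bullet> moment_curve s - b = poly p s"
    using affine_functional_of_poly[OF assms(1,2)] by metis
  then have av: "a \<bullet> v i = b + poly p (t i)" for i by (simp add: v_def algebra_simps flip: ab)
  have "convex hull {x \<in> v ` {1..n}. a \<bullet> x = b} face_of P"
    unfolding P_eq by (rule face_of_convex_hull_Int_hyperplane) (use pos in \<open>auto simp: av\<close>)
  moreover have "{x \<in> v ` {1..n}. a \<bullet> x = b} = v ` J" using zero assms(3) by (auto simp: av)
  ultimately show ?thesis by simp
qed

lemma vertex_extreme:
  assumes "j \<in> {1..n}"
  shows "v j extreme_point_of P"
proof -
  have "convex hull (v ` {j}) face_of P"
    by (rule face_of_nonneg_poly[where p = "[:- t j, 1:] ^ 2"])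
      (use assms dim t_eq_iff in \<open>auto simp: degree_power_eq\<close>)
  then show ?thesis by (simp add: face_of_singleton)
qed

definition edge :: "nat \<Rightarrow> nat \<Rightarrow> bool" where
  "edge j k \<longleftrightarrow> closed_segment (v j) (v k) face_of P"

lemma edge_commute: "edge j k \<longleftrightarrow> edge k j"
  by (simp add: edge_def closed_segment_commute)

lemma edgeI:
  assumes "j \<in> {1..n}" "k \<in> {1..n}" "degree p \<le> CARD('d)" "degree p \<ge> 1"
    and "\<And>i. i \<in> {1..n} \<Longrightarrow> poly p (t i) \<ge> 0"
    and "\<And>i. i \<in> {1..n} \<Longrightarrow> poly p (t i) = 0 \<longleftrightarrow> i = j \<or> i = k"
  shows "edge j k"
  using face_of_nonneg_poly[OF assms(3,4), of "{j, k}"] assms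
  by (simp add: edge_def segment_convex_hull)

definition slice_number :: "real poly \<Rightarrow> nat" where
  "slice_number p =
     card {j \<in> {1..n}. poly p (t j) = 0} +
     card {(j, k) \<in> {1..n} \<times> {1..n}. poly p (t j) > 0 \<and> poly p (t k) < 0 \<and> edge j k}"

lemma slice_count:
  assumes p: "\<And>s. poly p s = a \<bullet> moment_curve s - b"
  shows "slice_vertex_count P {z. a \<bullet> z = b} = slice_number p"
proof -
  have av: "a \<bullet> v i = b + poly p (t i)" for i by (simp add: v_def p)
  have 1: "{x \<in> v ` {1..n}. a \<bullet> x = b} = v ` {j \<in> {1..n}. poly p (t j) = 0}"
    by (auto simp: av)
  have 2: "{(x, y) \<in> v ` {1..n} \<times> v ` {1..n}. a \<bullet> x > b \<and> a \<bullet> y < b \<and> closed_segment x y face_of P} =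
      map_prod v v ` {(j, k) \<in> {1..n} \<times> {1..n}. poly p (t j) > 0 \<and> poly p (t k) < 0 \<and> edge j k}"
    by (force simp: av edge_def)
  have "slice_vertex_count P {z. a \<bullet> z = b} = card {x \<in> v ` {1..n}. a \<bullet> x = b} +
     card {(x, y) \<in> v ` {1..n} \<times> v ` {1..n}. a \<bullet> x > b \<and> a \<bullet> y < b \<and> closed_segment x y face_of P}"
    unfolding P_eq
    by (rule slice_vertex_count_convex_hull) (use vertex_extreme in \<open>auto simp: P_eq\<close>)
  moreover have "inj_on (map_prod v v) ({1..n} \<times> {1..n})" using inj_v by (intro map_prod_inj_on)
  ultimately show ?thesis unfolding 1 2 slice_number_def
    using inj_v by (subst (asm) card_image, blast intro: inj_on_subset,
      subst (asm) card_image, blast intro: inj_on_subset)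
qed

text \<open>
  Hyperplanes are replaced by polynomials of degree \<open>1, \<dots>, d\<close>, and the requirement that the hyperplane
  meets the polytope by positivity of the count, since a nonempty compact convex slice has an extreme
  point and the empty slice has none.
\<close>

lemma vertex_slice_sequence_eq:
  "vertex_slice_sequence P =
     {m. m > 0 \<and> (\<exists>p. 1 \<le> degree p \<and> degree p \<le> CARD('d) \<and> m = slice_number p)}"
proof (intro set_eqI iffI)
  fix m assume "m \<in> vertex_slice_sequence P"
  then obtain a b where ab: "a \<noteq> 0" "{z. a \<bullet> z = b} \<inter> P \<noteq> {}"
    "m = slice_vertex_count P {z. a \<bullet> z = b}"
    by (auto simp: vertex_slice_sequence_def affine_hyperplanes_meeting_def)
  obtain p where p: "degree p \<ge> 1" "degree p \<le> CARD('d)" "\<And>s. poly p s = a \<bullet> moment_curve s - b"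
    using poly_of_affine_functional[OF ab(1)] by metis
  have "polytope P" unfolding P_eq by (simp add: polytope_convex_hull)
  then have poly: "polytope ({z. a \<bullet> z = b} \<inter> P)"
    by (simp add: polyhedron_Int_polytope polyhedron_hyperplane)
  then obtain x where "x extreme_point_of ({z. a \<bullet> z = b} \<inter> P)"
    using ab(2) extreme_point_exists_convex polytope_imp_compact polytope_imp_convex by metis
  moreover have "finite {x. x extreme_point_of ({z. a \<bullet> z = b} \<inter> P)}"
    using poly by (intro finite_polyhedron_extreme_points polytope_imp_polyhedron)
  ultimately have "m > 0"
    unfolding ab(3) slice_vertex_count_def vertices_def by (auto simp: card_gt_0_iff)
  then show "m \<in> {m. m > 0 \<and> (\<exists>p. 1 \<le> degree p \<and> degree p \<le> CARD('d) \<and> m = slice_number p)}"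
    using p slice_count[OF p(3)] ab(3) by auto
next
  fix m assume "m \<in> {m. m > 0 \<and> (\<exists>p. 1 \<le> degree p \<and> degree p \<le> CARD('d) \<and> m = slice_number p)}"
  then obtain p where m: "m > 0" "m = slice_number p" and p: "degree p \<le> CARD('d)" "1 \<le> degree p"
    by auto
  obtain a :: "real ^ 'd::{finite,linorder}" and b
    where ab: "a \<noteq> 0" "\<And>s. a \<bullet> moment_curve s - b = poly p s"
    using affine_functional_of_poly[OF p] by metis
  have count: "m = slice_vertex_count P {z. a \<bullet> z = b}"
    using slice_count[of p a b] ab(2) m(2) by simp
  have "{z. a \<bullet> z = b} \<inter> P \<noteq> {}"
    using m(1) unfolding count slice_vertex_count_def vertices_def
    by (auto simp: card_gt_0_iff extreme_point_of_def)
  then show "m \<in> vertex_slice_sequence P"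
    unfolding vertex_slice_sequence_def affine_hyperplanes_meeting_def count using ab(1) by blast
qed

lemma card_roots_le_degree:
  assumes "p \<noteq> 0"
  shows "card {j \<in> {1..n}. poly p (t j) = 0} \<le> degree p"
proof -
  have "inj_on t {j \<in> {1..n}. poly p (t j) = 0}" using t_eq_iff by (auto simp: inj_on_def)
  then have "card {j \<in> {1..n}. poly p (t j) = 0} = card (t ` {j \<in> {1..n}. poly p (t j) = 0})"
    by (simp add: card_image)
  also have "\<dots> \<le> card {x. poly p x = 0}"
    using assms by (intro card_mono poly_roots_finite) auto
  also have "\<dots> \<le> degree p" using assms by (rule card_poly_roots_bound)
  finally show ?thesis .
qed

section \<open>Edges of the cyclic polytope\<close>

lemma edge_neighborly:
  assumes "CARD('d) \<ge> 4" "j \<in> {1..n}" "k \<in> {1..n}"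
  shows "edge j k"
proof (rule edgeI)
  let ?p = "([:- t j, 1:] * [:- t k, 1:]) ^ 2"
  have "degree ?p = 4" by (simp add: degree_power_eq degree_mult_eq)
  then show "degree ?p \<le> CARD('d)" "degree ?p \<ge> 1" using assms by auto
  have val: "poly ?p x = ((x - t j) * (x - t k))\<^sup>2" for x
    by (simp only: poly_mult poly_power poly_linear_factor)
  fix i assume i: "i \<in> {1..n}"
  show "poly ?p (t i) \<ge> 0" unfolding val by simp
  show "poly ?p (t i) = 0 \<longleftrightarrow> i = j \<or> i = k"
    unfolding val using t_eq_iff[OF i assms(2)] t_eq_iff[OF i assms(3)] by auto
qed (use assms in auto)

text \<open>
  The supporting polynomials of this and the next two lemmas have degree at most three and do not
  change sign on the parameters, because their simple roots lie at the ends or at two neighbouring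
  parameters.
\<close>

lemma edge_first:
  assumes "j \<in> {2..n}"
  shows "edge 1 j"
proof (rule edgeI)
  let ?p = "[:- t 1, 1:] * [:- t j, 1:] ^ 2"
  have "degree ?p = 3" by (subst degree_mult_eq) (auto simp: degree_power_eq)
  then show "degree ?p \<le> CARD('d)" "degree ?p \<ge> 1" using dim by auto
  fix i assume i: "i \<in> {1..n}"
  have val: "poly ?p x = (x - t 1) * (x - t j)\<^sup>2" for x
    by (simp only: poly_mult poly_power poly_linear_factor)
  have "t i - t 1 \<ge> 0" using t_le_iff[of 1 i] i by auto
  then show "poly ?p (t i) \<ge> 0" unfolding val by (intro mult_nonneg_nonneg) auto
  show "poly ?p (t i) = 0 \<longleftrightarrow> i = 1 \<or> i = j"
    unfolding val using i assms t_eq_iff[of i 1] t_eq_iff[of i j] by auto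
qed (use assms in auto)

lemma edge_last:
  assumes "j \<in> {1..n}"
  shows "edge j n"
proof (rule edgeI)
  let ?p = "[:t n, - 1:] * [:- t j, 1:] ^ 2"
  have "degree ?p = 3" by (subst degree_mult_eq) (auto simp: degree_power_eq)
  then show "degree ?p \<le> CARD('d)" "degree ?p \<ge> 1" using dim by auto
  fix i assume i: "i \<in> {1..n}"
  have val: "poly ?p x = (t n - x) * (x - t j)\<^sup>2" for x
    by (simp only: poly_mult poly_power poly_linear_factor)
  have "t n - t i \<ge> 0" using t_le_iff[of i n] i by auto
  then show "poly ?p (t i) \<ge> 0" unfolding val by (intro mult_nonneg_nonneg) auto
  show "poly ?p (t i) = 0 \<longleftrightarrow> i = j \<or> i = n"
    unfolding val using i assms t_eq_iff[of i n] t_eq_iff[of i j] by auto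
qed (use assms in auto)

lemma edge_Suc:
  assumes "j \<in> {1..n - 1}"
  shows "edge j (Suc j)"
proof (rule edgeI)
  let ?p = "[:- t j, 1:] * [:- t (Suc j), 1:]"
  have "degree ?p = 2" by (subst degree_mult_eq) auto
  then show "degree ?p \<le> CARD('d)" "degree ?p \<ge> 1" using dim by auto
  have jn: "j \<in> {1..n}" "Suc j \<in> {1..n}" using assms by auto
  then show "j \<in> {1..n}" "Suc j \<in> {1..n}" by auto
  fix i assume i: "i \<in> {1..n}"
  have "(t i \<le> t j \<and> t i \<le> t (Suc j)) \<or> (t i \<ge> t j \<and> t i \<ge> t (Suc j))"
    using t_le_iff[OF i jn(1)] t_le_iff[OF i jn(2)] t_le_iff[OF jn(1) i] t_le_iff[OF jn(2) i] by linarith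
  then have "(t i - t j) * (t i - t (Suc j)) \<ge> 0"
    by (auto intro: mult_nonpos_nonpos mult_nonneg_nonneg)
  moreover have val: "poly ?p x = (x - t j) * (x - t (Suc j))" for x
    by (simp only: poly_mult poly_linear_factor)
  ultimately show "poly ?p (t i) \<ge> 0" by simp
  show "poly ?p (t i) = 0 \<longleftrightarrow> i = j \<or> i = Suc j"
    unfolding val using t_eq_iff[OF i jn(1)] t_eq_iff[OF i jn(2)] by auto
qed

text \<open>
  An edge is an exposed face, so it comes with a polynomial \<open>p\<close> of degree at most three which vanishes at
  \<open>t\<^sub>j\<close> and \<open>t\<^sub>k\<close> and is positive at all other parameters.  Then \<open>p = (x - t\<^sub>j) (x - t\<^sub>k) l\<close> with \<open>l\<close> of
  degree at most one.  For a pair other than the listed ones there are parameters before \<open>t\<^sub>j\<close>, between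
  \<open>t\<^sub>j\<close> and \<open>t\<^sub>k\<close>, and after \<open>t\<^sub>k\<close>, at which \<open>l\<close> would be positive, negative and positive: impossible for
  an affine function.
\<close>

lemma edge_cases_dim3:
  assumes d3: "CARD('d) = 3" and jk: "1 \<le> j" "j < k" "k \<le> n" and edge: "edge j k"
  shows "j = 1 \<or> k = n \<or> k = Suc j"
proof (rule ccontr)
  assume "\<not> ?thesis"
  then have lt: "1 < j" "Suc j < k" "k < n" using jk by auto
  have "polyhedron P" unfolding P_eq by (simp add: polytope_convex_hull polytope_imp_polyhedron)
  then have "closed_segment (v j) (v k) exposed_face_of P"
    using edge by (simp add: edge_def exposed_face_of_polyhedron)
  moreover have not_in: "v i \<notin> closed_segment (v j) (v k)" if i: "i \<in> {1..n}" "i \<noteq> j" "i \<noteq> k" for i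
  proof
    assume "v i \<in> closed_segment (v j) (v k)"
    then have "v i extreme_point_of (convex hull {v j, v k})"
      using vertex_extreme[OF i(1)] extreme_point_of_face edge
      unfolding edge_def segment_convex_hull by blast
    then have "v i \<in> {v j, v k}" by (rule extreme_point_of_convex_hull)
    then show False using i jk lt inj_onD[OF inj_v, of i] by auto
  qed
  moreover have inP: "v i \<in> P" if "i \<in> {1..n}" for i
    using vertex_extreme[OF that] by (simp add: extreme_point_of_def)
  have "v 1 \<in> P" using inP lt by auto
  moreover have "v 1 \<notin> closed_segment (v j) (v k)" using lt not_in by auto
  ultimately obtain a b where ab: "a \<noteq> 0" "P \<subseteq> {x. a \<bullet> x \<le> b}"
    "closed_segment (v j) (v k) = P \<inter> {x. a \<bullet> x = b}"
    unfolding exposed_face_of by auto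
  obtain p where p: "degree p \<le> 3" "\<And>s. poly p s = (- a) \<bullet> moment_curve s - (- b)"
    using poly_of_affine_functional[of "- a"] ab(1) d3 by (metis neg_equal_0_iff_equal)
  have pv: "poly p (t i) = b - a \<bullet> v i" for i using p(2) by (simp add: v_def)
  have pos: "poly p (t i) > 0" if "i \<in> {1..n}" "i \<noteq> j" "i \<noteq> k" for i
    using not_in[OF that] inP[OF that(1)] ab(2) unfolding ab(3) pv by (auto simp: less_le)
  have "v j \<in> closed_segment (v j) (v k)" "v k \<in> closed_segment (v j) (v k)" by auto
  then have zero: "poly p (t j) = 0" "poly p (t k) = 0" unfolding ab(3) pv by auto
  obtain q where q: "p = [:- t j, 1:] * q" using zero(1) by (auto simp: poly_eq_0_iff_dvd dvd_def)
  have tjk: "t j < t k" using t_less_iff[of j k] jk by auto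
  have "poly q (t k) = 0" using zero(2) tjk unfolding q by simp
  then obtain l where l: "q = [:- t k, 1:] * l" by (auto simp: poly_eq_0_iff_dvd dvd_def)
  have pl: "poly p s = (s - t j) * (s - t k) * poly l s" for s unfolding q l by (simp add: algebra_simps)
  have "l \<noteq> 0" using pos[of 1] lt by (auto simp: pl)
  then have "degree q = degree l + 1" unfolding l by (subst degree_mult_eq) auto
  moreover have "q \<noteq> 0" using calculation by auto
  then have "degree p = degree q + 1" unfolding q by (subst degree_mult_eq) auto
  ultimately have "degree p = degree l + 2" by simp
  then have "degree l \<le> 1" using p(1) by simp
  then obtain c e where ce: "l = [:c, e:]" by (metis degree1_coeffs degree_eq_zeroE le_Suc_eq One_nat_def le_zero_eq pCons_0_0)
  have "t 1 < t j" "t k < t n" "t j < t (Suc j)" "t (Suc j) < t k"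
    using t_less_iff lt by auto
  note ts = this
  have "poly p (t 1) > 0" "poly p (t (Suc j)) > 0" "poly p (t n) > 0" using pos lt by auto
  moreover have "(t 1 - t j) * (t 1 - t k) > 0" using ts tjk by (intro mult_neg_neg) auto
  moreover have "(t (Suc j) - t j) * (t (Suc j) - t k) < 0" using ts by (intro mult_pos_neg) auto
  moreover have "(t n - t j) * (t n - t k) > 0" using ts tjk by (intro mult_pos_pos) auto
  ultimately have "poly l (t 1) > 0" "poly l (t (Suc j)) < 0" "poly l (t n) > 0"
    unfolding pl by (meson zero_less_mult_iff less_asym)+
  then have "e * (t (Suc j) - t 1) < 0" "e * (t n - t (Suc j)) > 0"
    unfolding ce by (auto simp: algebra_simps)
  then show False using ts by (auto simp: zero_less_mult_iff mult_less_0_iff)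
qed

section \<open>Sign patterns of polynomials\<close>

lemma slice_number_neighborly:
  assumes "CARD('d) \<ge> 4"
  shows "slice_number p = card {j \<in> {1..n}. poly p (t j) = 0} +
     card {j \<in> {1..n}. poly p (t j) > 0} * card {j \<in> {1..n}. poly p (t j) < 0}"
proof -
  have "{(j, k) \<in> {1..n} \<times> {1..n}. poly p (t j) > 0 \<and> poly p (t k) < 0 \<and> edge j k} =
      {j \<in> {1..n}. poly p (t j) > 0} \<times> {j \<in> {1..n}. poly p (t j) < 0}"
    using edge_neighborly[OF assms] by auto
  then show ?thesis by (simp add: slice_number_def card_cartesian_product)
qed

lemma sign_counts_sum:
  "card {j \<in> {1..n}. poly p (t j) > 0} + card {j \<in> {1..n}. poly p (t j) < 0} +
   card {j \<in> {1..n}. poly p (t j) = 0} = n"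
proof -
  let ?N = "{j \<in> {1..n}. poly p (t j) < 0}" and ?Z = "{j \<in> {1..n}. poly p (t j) = 0}"
  let ?P = "{j \<in> {1..n}. poly p (t j) > 0}"
  have "card (?P \<union> ?N \<union> ?Z) = card (?P \<union> ?N) + card ?Z"
    by (rule card_Un_disjoint) auto
  also have "card (?P \<union> ?N) = card ?P + card ?N" by (rule card_Un_disjoint) auto
  also have "?P \<union> ?N \<union> ?Z = {1..n}" by auto
  finally show ?thesis by simp
qed

text \<open>
  The monic polynomial with simple roots at \<open>m\<close> consecutive parameters has an odd number of negative
  factors to the left of its roots and only positive factors to the right.
\<close>

lemma consecutive_roots:
  assumes "odd m" "a + m \<le> n"
  obtains q where "degree q = m"
    "\<And>j. j \<in> {1..n} \<Longrightarrow> poly q (t j) < 0 \<longleftrightarrow> j \<le> a"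
    "\<And>j. j \<in> {1..n} \<Longrightarrow> poly q (t j) = 0 \<longleftrightarrow> j \<in> {a + 1..a + m}"
proof
  let ?A = "{a + 1..a + m}"
  let ?q = "\<Prod>k\<in>?A. [:- t k, 1:]"
  have A: "?A \<subseteq> {1..n}" using assms by auto
  show "degree ?q = m" by (subst degree_prod_eq_sum_degree) auto
  have qv: "poly ?q x = (\<Prod>k\<in>?A. x - t k)" for x by (simp add: poly_prod)
  fix j assume j: "j \<in> {1..n}"
  have "(t j - t k = 0) \<longleftrightarrow> j = k" if "k \<in> ?A" for k
    using t_eq_iff[OF j] A that by (simp add: subset_iff)
  then show zero: "poly ?q (t j) = 0 \<longleftrightarrow> j \<in> ?A"
    unfolding qv by (metis finite_atLeastAtMost prod_zero_iff)
  show "poly ?q (t j) < 0 \<longleftrightarrow> j \<le> a"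
  proof
    assume ja: "j \<le> a"
    have "(\<Prod>k\<in>?A. t j - t k) = (\<Prod>k\<in>?A. (- 1) * (t k - t j))" by simp
    also have "\<dots> = - (\<Prod>k\<in>?A. t k - t j)"
      unfolding prod.distrib using assms(1) by simp
    finally have "poly ?q (t j) = - (\<Prod>k\<in>?A. t k - t j)" unfolding qv .
    moreover have "(\<Prod>k\<in>?A. t k - t j) > 0"
      using ja j A t_less_iff[OF j] by (intro prod_pos) auto
    ultimately show "poly ?q (t j) < 0" by simp
  next
    assume neg: "poly ?q (t j) < 0"
    show "j \<le> a"
    proof (rule ccontr)
      assume "\<not> j \<le> a"
      then have "j > a + m" using neg zero by auto
      then have "(\<Prod>k\<in>?A. t j - t k) > 0"
        using j A t_less_iff[OF _ j] by (intro prod_pos) auto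
      then show False using neg unfolding qv by simp
    qed
  qed
qed

text \<open>
  Realizes every distribution of the parameters to the two sides.  An odd number \<open>i\<close> of roots is
  placed consecutively.  For even positive \<open>i\<close> one of them is moved to \<open>t\<^sub>n\<close>, where its factor
  \<open>t\<^sub>n - x\<close> is positive at the other parameters, and for \<open>i = 0\<close> a linear polynomial separates the two
  groups; this is the only case in which both groups have to be nonempty.
\<close>

lemma sign_pattern_realizable:
  assumes abi: "a + b + i = n" "i \<le> CARD('d)" "i = 0 \<Longrightarrow> a \<ge> 1 \<and> b \<ge> 1"
  obtains p where "1 \<le> degree p" "degree p \<le> CARD('d)"
    "card {j \<in> {1..n}. poly p (t j) = 0} = i"
    "card {j \<in> {1..n}. poly p (t j) > 0} = b" "card {j \<in> {1..n}. poly p (t j) < 0} = a"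
proof -
  note realized = that
  have finish: thesis if fin: "1 \<le> degree p" "degree p \<le> CARD('d)"
    "{j \<in> {1..n}. poly p (t j) = 0} = Z" "card Z = i"
    "{j \<in> {1..n}. poly p (t j) < 0} = {1..a}" for p Z
  proof (rule realized[of p])
    show "card {j \<in> {1..n}. poly p (t j) > 0} = b"
      using sign_counts_sum[of p] abi(1) fin(4) unfolding fin(3,5) by simp
  qed (use fin in auto)
  consider "i = 0" | "odd i" | "even i" "i > 0" by auto
  then show ?thesis
  proof cases
    case 1
    then have a: "a \<in> {1..n}" "Suc a \<in> {1..n}" using abi by auto
    let ?c = "(t a + t (Suc a)) / 2" let ?p = "[:- ?c, 1:]"
    have tc: "t a < ?c" "?c < t (Suc a)" using t_less_iff[OF a] by auto
    have sgn: "if j \<le> a then poly ?p (t j) < 0 else poly ?p (t j) > 0" if "j \<in> {1..n}" for j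
      using t_le_iff[OF that a(1)] t_le_iff[OF a(2) that] tc by (auto simp: not_le Suc_le_eq)
    have sgn1: "poly ?p (t j) < 0 \<longleftrightarrow> j \<le> a" "poly ?p (t j) \<noteq> 0" if "j \<in> {1..n}" for j
      using sgn[OF that] by (auto split: if_splits simp del: poly_pCons)
    show ?thesis
    proof (rule finish[of ?p "{}"])
      show "{j \<in> {1..n}. poly ?p (t j) = 0} = {}" using sgn1 by (auto simp del: poly_pCons)
      show "{j \<in> {1..n}. poly ?p (t j) < 0} = {1..a}" using sgn1 a by (auto simp del: poly_pCons)
    qed (use dim 1 in auto)
  next
    case 2
    obtain q where q: "degree q = i" "\<And>j. j \<in> {1..n} \<Longrightarrow> poly q (t j) < 0 \<longleftrightarrow> j \<le> a"
      "\<And>j. j \<in> {1..n} \<Longrightarrow> poly q (t j) = 0 \<longleftrightarrow> j \<in> {a + 1..a + i}"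
      using consecutive_roots[OF 2, of a] abi(1) by auto
    show ?thesis
    proof (rule finish[of q "{a + 1..a + i}"])
      show "{j \<in> {1..n}. poly q (t j) = 0} = {a + 1..a + i}" using q(3) abi(1) by auto
      show "{j \<in> {1..n}. poly q (t j) < 0} = {1..a}" using q(2) abi(1) by auto
    qed (use q abi 2 in \<open>auto elim: oddE\<close>)
  next
    case 3
    then have odd: "odd (i - 1)" and le: "a + (i - 1) \<le> n" using abi(1) by auto
    obtain q where q: "degree q = i - 1" "\<And>j. j \<in> {1..n} \<Longrightarrow> poly q (t j) < 0 \<longleftrightarrow> j \<le> a"
      "\<And>j. j \<in> {1..n} \<Longrightarrow> poly q (t j) = 0 \<longleftrightarrow> j \<in> {a + 1..a + (i - 1)}"
      using consecutive_roots[OF odd le] by metis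
    have "q \<noteq> 0" using q(1) 3 odd by (auto elim: oddE)
    then have deg: "degree ([:t n, - 1:] * q) = i"
      using q(1) 3 by (subst degree_mult_eq) auto
    have val: "poly ([:t n, - 1:] * q) x = (t n - x) * poly q x" for x by (simp add: algebra_simps)
    have tn: "j = n \<or> t n - t j > 0" if "j \<in> {1..n}" for j using t_less_iff[of j n] that by auto
    show ?thesis
    proof (rule finish[of "[:t n, - 1:] * q" "insert n {a + 1..a + (i - 1)}"])
      have an: "a < n" using abi(1) 3 by simp
      have "(t n - t j) * poly q (t j) = 0 \<longleftrightarrow> j = n \<or> j \<in> {a + 1..a + (i - 1)}"
        if "j \<in> {1..n}" for j using tn[OF that] q(3)[OF that] by auto
      then have "{j \<in> {1..n}. poly ([:t n, - 1:] * q) (t j) = 0} =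
          {j \<in> {1..n}. j = n \<or> j \<in> {a + 1..a + (i - 1)}}"
        unfolding val by blast
      also have "\<dots> = insert n {a + 1..a + (i - 1)}" using le an by auto
      finally show "{j \<in> {1..n}. poly ([:t n, - 1:] * q) (t j) = 0} = insert n {a + 1..a + (i - 1)}" .
      have "(t n - t j) * poly q (t j) < 0 \<longleftrightarrow> j \<le> a" if "j \<in> {1..n}" for j
        using tn[OF that] q(2)[OF that] an by (auto simp: mult_less_0_iff)
      then have "{j \<in> {1..n}. poly ([:t n, - 1:] * q) (t j) < 0} = {j \<in> {1..n}. j \<le> a}"
        unfolding val by blast
      also have "\<dots> = {1..a}" using an by auto
      finally show "{j \<in> {1..n}. poly ([:t n, - 1:] * q) (t j) < 0} = {1..a}" .
      have "n \<notin> {a + 1..a + (i - 1)}" using abi(1) 3 by auto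
      then show "card (insert n {a + 1..a + (i - 1)}) = i" using 3 by simp
    qed (use deg abi(2) 3 in auto)
  qed
qed

section \<open>Slices in dimension three\<close>

text \<open>
  Crossed edges are sorted into the edge between the two ends (\<open>X\<close>), edges from an end to one of the
  \<open>n - 2\<close> middle vertices (\<open>A\<close>, \<open>B\<close>), and edges between two neighbouring middle vertices (\<open>Q\<close>), of which
  there are \<open>n - 3\<close>.  If the ends have opposite signs, or just one of them is on the hyperplane, each
  middle vertex accounts for at most one element of \<open>A\<close>, \<open>B\<close> and the middle zeros, and \<open>X\<close> and the ends
  contribute one more.  If both ends are on the hyperplane, only \<open>Q\<close> and at most three zeros remain.  If the
  ends have the same sign, a middle vertex of the opposite sign accounts for two edges to the ends;
  but each element of \<open>Q\<close> contains a middle vertex that has the sign of the ends, and such a vertex is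
  contained in at most two of them.
\<close>

lemma slice_number_le_dim3:
  assumes d3: "CARD('d) = 3" and p: "p \<noteq> 0" "degree p \<le> 3"
  shows "slice_number p \<le> 2 * (n - 2)"
proof -
  have n: "n \<ge> 4" using size d3 by simp
  define f where "f j = poly p (t j)" for j
  define Z where "Z = {j \<in> {1..n}. f j = 0}"
  define D where "D = {(j, k) \<in> {1..n} \<times> {1..n}. f j > 0 \<and> f k < 0 \<and> edge j k}"
  have number: "slice_number p = card Z + card D" by (simp add: slice_number_def Z_def D_def f_def)
  let ?mid = "{2..n - 1}"
  define Zm where "Zm = {j \<in> ?mid. f j = 0}"
  define A where "A = {j \<in> ?mid. f 1 * f j < 0}"
  define B where "B = {j \<in> ?mid. f j * f n < 0}"
  define Q where "Q = {j \<in> {2..n - 2}. f j * f (Suc j) < 0}"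
  define X :: "(nat \<times> nat) set" where "X = (if f 1 * f n < 0 then {(1, n)} else {})"
  have fin: "finite Zm" "finite A" "finite B" "finite Q" "finite X"
    by (auto simp: Zm_def A_def B_def Q_def X_def)
  let ?C = "X \<union> (Pair 1 ` A \<union> ((\<lambda>j. (j, n)) ` B \<union> (\<lambda>j. (j, Suc j)) ` Q))"
  have C: "(x, y) \<in> ?C" if xy: "1 \<le> x" "x < y" "y \<le> n" "edge x y" "f x * f y < 0" for x y
  proof -
    consider "x = 1" "y = n" | "x = 1" "y < n" | "x > 1" "y = n" | "x > 1" "y < n" "y = Suc x"
      using edge_cases_dim3[OF d3 xy(1-4)] xy by linarith
    then show ?thesis
    proof cases
      case 1 then show ?thesis using xy(5) by (simp add: X_def)
    next
      case 2 then show ?thesis using xy by (auto simp: A_def)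
    next
      case 3 then show ?thesis using xy by (auto simp: B_def)
    next
      case 4 then show ?thesis using xy by (auto simp: Q_def)
    qed
  qed
  (* Pairs in D run from the positive to the negative end, those in the bound from left to right. *)
  let ?\<phi> = "\<lambda>(j::nat, k). (min j k, max j k)"
  have "?\<phi> ` D \<subseteq> ?C"
  proof (rule image_subsetI)
    fix e assume "e \<in> D"
    then obtain j k where e: "e = (j, k)" and jk: "1 \<le> j" "j \<le> n" "1 \<le> k" "k \<le> n" "f j > 0" "f k < 0" "edge j k"
      by (auto simp: D_def)
    have "f j * f k < 0" using jk by (simp add: mult_less_0_iff)
    moreover have "j \<noteq> k" using jk by auto
    ultimately show "?\<phi> e \<in> ?C" unfolding e
      using C[of j k] C[of k j] jk edge_commute
      by (cases "j < k") (auto simp: min_def max_def mult.commute simp del: Un_iff)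
  qed
  moreover have "inj_on ?\<phi> D"
    by (auto simp: inj_on_def D_def min_def max_def split: if_splits)
  ultimately have "card D \<le> card ?C" using fin by (intro card_inj_on_le) auto
  also have "\<dots> \<le> card X + (card A + (card B + card Q))"
    by (intro card_Un_le[THEN order_trans] add_mono card_image_le fin order_refl)
  finally have D: "card D \<le> card X + card A + card B + card Q" by simp
  have end1: "{1} \<inter> Z = (if f 1 = 0 then {1} else {})"
    and endn: "{n} \<inter> Z = (if f n = 0 then {n} else {})"
    using n by (auto simp: Z_def)
  have "Z = Zm \<union> ({1} \<inter> Z \<union> {n} \<inter> Z)"
    using n by (auto simp: Z_def Zm_def)
  then have "card Z \<le> card Zm + (card ({1} \<inter> Z) + card ({n} \<inter> Z))"
    by (metis card_Un_le add_left_mono order_trans)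
  then have Z: "card Z \<le> card Zm + (if f 1 = 0 then 1 else 0) + (if f n = 0 then 1 else 0)"
    unfolding end1 endn by (cases "f 1 = 0"; cases "f n = 0") simp_all
  have "card Q \<le> card {2..n - 2}" by (rule card_mono) (auto simp: Q_def)
  then have Q: "card Q \<le> n - 3" by simp
  have X: "card X \<le> 1" by (simp add: X_def)
  have mid: "card (U \<union> V \<union> W) \<le> n - 2"
    if "U \<subseteq> ?mid" "V \<subseteq> ?mid" "W \<subseteq> ?mid" for U V W
    using card_mono[of ?mid "U \<union> V \<union> W"] that by simp
  have mid3: "card U + card V + card W \<le> n - 2"
    if "U \<subseteq> ?mid" "V \<subseteq> ?mid" "W \<subseteq> ?mid" "U \<inter> V = {}" "U \<inter> W = {}" "V \<inter> W = {}" for U V W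
  proof -
    have "finite U" "finite V" "finite W" using that(1-3) by (auto intro: finite_subset)
    then have "card (U \<union> V \<union> W) = card U + card V + card W"
      using that(4-6) by (simp add: card_Un_disjoint Int_Un_distrib2)
    then show ?thesis using mid[OF that(1-3)] by simp
  qed
  have sub: "A \<subseteq> ?mid" "B \<subseteq> ?mid" "Zm \<subseteq> ?mid" by (auto simp: A_def B_def Zm_def)
  show ?thesis
  proof (cases "f 1 * f n > 0")
    case True
    define R where "R = {j \<in> ?mid. f 1 * f j > 0}"
    have AB: "A = B" using True by (auto simp: A_def B_def zero_less_mult_iff mult_less_0_iff)
    have part: "card A + card Zm + card R \<le> n - 2"
      by (rule mid3) (auto simp: A_def Zm_def R_def)
    have "Q \<subseteq> R \<union> (\<lambda>j. j - 1) ` R"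
    proof
      fix j assume j: "j \<in> Q"
      then have "j \<in> ?mid" "Suc j \<in> ?mid" using n by (auto simp: Q_def)
      moreover have "f 1 * f j > 0 \<or> f 1 * f (Suc j) > 0"
        using j True by (auto simp: Q_def zero_less_mult_iff mult_less_0_iff)
      ultimately have "j \<in> R \<or> Suc j \<in> R" by (auto simp: R_def)
      then show "j \<in> R \<union> (\<lambda>j. j - 1) ` R" by force
    qed
    moreover have "finite R" by (simp add: R_def)
    ultimately have "card Q \<le> card (R \<union> (\<lambda>j. j - 1) ` R)" by (intro card_mono) auto
    also have "\<dots> \<le> card R + card ((\<lambda>j. j - 1) ` R)" by (rule card_Un_le)
    also have "\<dots> \<le> card R + card R" using card_image_le[OF \<open>finite R\<close>] by simp
    finally have "card Q \<le> card R + card R" .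
    moreover have "card X = 0" "f 1 \<noteq> 0" "f n \<noteq> 0" using True by (auto simp: X_def)
    ultimately show ?thesis using part D Z n unfolding number AB by simp
  next
    case False
    show ?thesis
    proof (cases "f 1 = 0 \<and> f n = 0")
      case True
      then have "A = {}" "B = {}" "X = {}" by (auto simp: A_def B_def X_def)
      moreover have "card Z \<le> 3"
        using card_roots_le_degree[OF p(1)] p(2) by (simp add: Z_def f_def)
      ultimately show ?thesis using D Q n unfolding number by simp
    next
      case nz: False
      have "card A + card B + card Zm \<le> n - 2"
        by (rule mid3) (use False nz sub in \<open>auto simp: A_def B_def Zm_def zero_less_mult_iff mult_less_0_iff\<close>)
      moreover have "card X + (if f 1 = 0 then 1 else 0) + (if f n = 0 then 1 else 0) \<le> 1"
        using nz X by (auto simp: X_def)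
      ultimately show ?thesis using D Z Q n unfolding number by linarith
    qed
  qed
qed

text \<open>
  If the vertices above the hyperplane are those from \<open>l\<close> to \<open>r\<close>, all their edges to the two ends are
  crossed, and at each border of the interval one edge to the outer neighbour, unless this neighbour
  is an end and the edge has been counted already.
\<close>

lemma slice_number_interval_dim3:
  assumes d3: "CARD('d) = 3" and lr: "2 \<le> l" "l \<le> r" "r \<le> n - 1"
  obtains p where "degree p = 2"
    "slice_number p = 2 * (r + 1 - l) + (if l \<ge> 3 then 1 else 0) + (if r \<le> n - 2 then 1 else 0)"
proof
  have n: "n \<ge> 4" using size d3 by simp
  define \<alpha> where "\<alpha> = (t (l - 1) + t l) / 2"
  define \<beta> where "\<beta> = (t r + t (Suc r)) / 2"
  let ?p = "[:- \<alpha>, 1:] * [:\<beta>, - 1:]"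
  show "degree ?p = 2" by (subst degree_mult_eq) auto
  have val: "poly ?p x = (x - \<alpha>) * (\<beta> - x)" for x
    by (simp only: poly_mult poly_linear_factor)
  have range: "l - 1 \<in> {1..n}" "l \<in> {1..n}" "r \<in> {1..n}" "Suc r \<in> {1..n}" using lr by auto
  have ab: "t (l - 1) < \<alpha>" "\<alpha> < t l" "t r < \<beta>" "\<beta> < t (Suc r)"
    using t_less_iff[OF range(1,2)] t_less_iff[OF range(3,4)] lr by (auto simp: \<alpha>_def \<beta>_def)
  have \<alpha>: "if j < l then t j < \<alpha> else \<alpha> < t j" if "j \<in> {1..n}" for j
    using t_le_iff[OF that range(1)] t_le_iff[OF range(2) that] ab lr by auto
  have \<beta>: "if j \<le> r then t j < \<beta> else \<beta> < t j" if "j \<in> {1..n}" for j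
    using t_le_iff[OF that range(3)] t_le_iff[OF range(4) that] ab lr by auto
  have pos: "poly ?p (t j) > 0 \<longleftrightarrow> l \<le> j \<and> j \<le> r"
    and nz: "poly ?p (t j) \<noteq> 0" if "j \<in> {1..n}" for j
    using \<alpha>[OF that] \<beta>[OF that] ab t_le_iff[OF range(2,3)] lr unfolding val
    by (auto simp: zero_less_mult_iff split: if_splits)
  have neg: "poly ?p (t j) < 0 \<longleftrightarrow> \<not> (l \<le> j \<and> j \<le> r)" if "j \<in> {1..n}" for j
    using pos[OF that] nz[OF that] by linarith
  let ?L = "if l \<ge> 3 then {(l, l - 1)} else {}" and ?R = "if r \<le> n - 2 then {(r, Suc r)} else {}"
  have "{(j, k) \<in> {1..n} \<times> {1..n}. poly ?p (t j) > 0 \<and> poly ?p (t k) < 0 \<and> edge j k} =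
      {l..r} \<times> {1, n} \<union> (?L \<union> ?R)" (is "?D = ?E")
  proof (intro subset_antisym subrelI)
    fix j k assume "(j, k) \<in> ?D"
    then have jk: "j \<in> {1..n}" "k \<in> {1..n}" "l \<le> j" "j \<le> r" "k < l \<or> r < k" "edge j k"
      using pos neg by auto
    then have "k < j \<or> j < k" by auto
    then have "k = 1 \<or> k = n \<or> k = Suc j \<or> j = Suc k"
      using edge_cases_dim3[OF d3, of j k] edge_cases_dim3[OF d3, of k j] jk edge_commute lr by auto
    then show "(j, k) \<in> ?E" using jk lr by auto
  next
    fix j k assume jk: "(j, k) \<in> ?E"
    then have inr: "j \<in> {1..n}" "k \<in> {1..n}" "l \<le> j" "j \<le> r" "k < l \<or> r < k"
      using lr n by (auto split: if_splits)
    have "k = 1 \<or> k = n \<or> k = Suc j \<or> j = Suc k" using jk lr by (auto split: if_splits)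
    then have "edge j k"
      using edge_first[of j] edge_last[of j] edge_Suc[of j] edge_Suc[of k] inr lr edge_commute by auto
    then show "(j, k) \<in> ?D" using inr pos neg by auto
  qed
  moreover have "card ?E = 2 * (r + 1 - l) + (if l \<ge> 3 then 1 else 0) + (if r \<le> n - 2 then 1 else 0)"
  proof -
    have "card ?E = card ({l..r} \<times> {1, n}) + card (?L \<union> ?R)"
      using lr n by (intro card_Un_disjoint) auto
    also have "card (?L \<union> ?R) = card ?L + card ?R"
      using lr n by (intro card_Un_disjoint) auto
    finally show ?thesis using n by (simp add: card_cartesian_product)
  qed
  moreover have "{j \<in> {1..n}. poly ?p (t j) = 0} = {}" using nz by auto
  ultimately show "slice_number ?p =
      2 * (r + 1 - l) + (if l \<ge> 3 then 1 else 0) + (if r \<le> n - 2 then 1 else 0)"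
    unfolding slice_number_def by simp
qed

lemma slice_number_first_roots:
  assumes "m \<in> {1, 2}"
  obtains p where "1 \<le> degree p" "degree p \<le> CARD('d)" "slice_number p = m"
proof -
  have m0: "0 + (n - m) + m = n" "m \<le> CARD('d)" "m \<noteq> 0" using assms size dim by auto
  have "(0::nat) \<ge> 1 \<and> n - m \<ge> 1" if "m = 0" using that m0 by simp
  from sign_pattern_realizable[OF m0(1,2) this] obtain p where p: "1 \<le> degree p"
    "degree p \<le> CARD('d)" "card {j \<in> {1..n}. poly p (t j) = 0} = m"
    "card {j \<in> {1..n}. poly p (t j) > 0} = n - m" "card {j \<in> {1..n}. poly p (t j) < 0} = 0" .
  have "{j \<in> {1..n}. poly p (t j) < 0} = {}" using p(5) by simp
  then have none: "{(j, k) \<in> {1..n} \<times> {1..n}. poly p (t j) > 0 \<and> poly p (t k) < 0 \<and> edge j k} = {}"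
    by blast
  have "slice_number p = m" unfolding slice_number_def p(3) none by simp
  then show ?thesis using that p(1,2) by blast
qed

lemma vertex_slice_sequence_dim3:
  assumes d3: "CARD('d) = 3"
  shows "vertex_slice_sequence P = {1..2 * (n - 2)}"
proof (intro subset_antisym subsetI)
  fix m assume "m \<in> vertex_slice_sequence P"
  then obtain p where "m > 0" "1 \<le> degree p" "degree p \<le> 3" "m = slice_number p"
    unfolding vertex_slice_sequence_eq using d3 by auto
  then show "m \<in> {1..2 * (n - 2)}"
    using slice_number_le_dim3[OF d3, of p] by fastforce
next
  fix m assume m: "m \<in> {1..2 * (n - 2)}"
  have n: "n \<ge> 4" using size d3 by simp
  have "\<exists>p. 1 \<le> degree p \<and> degree p \<le> 3 \<and> m = slice_number p"
  proof -
    (* An interval of h middle vertices gives 2 h + 1 if one of its borders is next to an end, and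
       2 h + 2 if none is; the interval of all middle vertices gives the maximum. *)
    consider "m \<in> {1, 2}" | "m = 2 * (n - 2)" | h where "m = 2 * h + 1" "1 \<le> h" "h \<le> n - 3"
      | h where "m = 2 * h + 2" "1 \<le> h" "h \<le> n - 4"
    proof (cases "even m")
      case True
      then obtain g where "m = 2 * g" by auto
      then show ?thesis using m n that(1,2) that(4)[of "g - 1"] by fastforce
    next
      case False
      then obtain g where "m = 2 * g + 1" by (auto elim: oddE)
      then show ?thesis using m n that(1) that(3)[of g] by fastforce
    qed
    then show ?thesis
    proof cases
      case 1
      then show ?thesis using slice_number_first_roots d3 by metis
    next
      case 2
      then have "2 \<le> (2::nat)" "2 \<le> n - 1" "n - 1 \<le> n - 1" using n by auto
      from slice_number_interval_dim3[OF d3 this] obtain p where p: "degree p = 2"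
        "slice_number p = 2 * (n - 1 + 1 - 2) + (if (2::nat) \<ge> 3 then 1 else 0) +
           (if n - 1 \<le> n - 2 then 1 else 0)" .
      then have "slice_number p = m" using 2 n by auto
      then show ?thesis using p(1) by (intro exI[of _ p]) auto
    next
      case 3
      then have "2 \<le> (2::nat)" "2 \<le> h + 1" "h + 1 \<le> n - 1" using n by auto
      from slice_number_interval_dim3[OF d3 this] obtain p where p: "degree p = 2"
        "slice_number p = 2 * (h + 1 + 1 - 2) + (if (2::nat) \<ge> 3 then 1 else 0) +
           (if h + 1 \<le> n - 2 then 1 else 0)" .
      then have "slice_number p = m" using 3 n by auto
      then show ?thesis using p(1) by (intro exI[of _ p]) auto
    next
      case 4
      then have "2 \<le> (3::nat)" "3 \<le> h + 2" "h + 2 \<le> n - 1" using n by auto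
      from slice_number_interval_dim3[OF d3 this] obtain p where p: "degree p = 2"
        "slice_number p = 2 * (h + 2 + 1 - 3) + (if (3::nat) \<ge> 3 then 1 else 0) +
           (if h + 2 \<le> n - 2 then 1 else 0)" .
      then have "slice_number p = m" using 4 n by auto
      then show ?thesis using p(1) by (intro exI[of _ p]) auto
    qed
  qed
  then show "m \<in> vertex_slice_sequence P"
    unfolding vertex_slice_sequence_eq using m d3 by auto
qed

section \<open>The vertex slice sequence in higher dimensions\<close>

text \<open>
  The bounds \<open>a, b \<le> n - 1\<close> exclude precisely the case in which all vertices lie strictly on one side
  of the hyperplane, that is, the empty slice.
\<close>

lemma vertex_slice_sequence_neighborly:
  assumes d4: "CARD('d) \<ge> 4"
  shows "vertex_slice_sequence P =
    {a * b + i | a b i. a \<in> {0..n - 1} \<and> b \<in> {0..n - 1} \<and> i \<in> {0..CARD('d)} \<and> a + b = n - i}"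
    (is "_ = ?R")
proof (intro subset_antisym subsetI)
  fix m assume "m \<in> vertex_slice_sequence P"
  then obtain p where p: "m > 0" "1 \<le> degree p" "degree p \<le> CARD('d)" "m = slice_number p"
    unfolding vertex_slice_sequence_eq by blast
  define a b i where abi: "a = card {j \<in> {1..n}. poly p (t j) > 0}"
    "b = card {j \<in> {1..n}. poly p (t j) < 0}" "i = card {j \<in> {1..n}. poly p (t j) = 0}"
  have m: "m = a * b + i" using slice_number_neighborly[OF d4, of p] p(4) by (simp add: abi)
  have "i \<le> CARD('d)" using card_roots_le_degree[of p] p by (fastforce simp: abi)
  moreover have "a + b + i = n" using sign_counts_sum[of p] by (simp add: abi)
  moreover have "a \<le> n - 1 \<and> b \<le> n - 1"
  proof (cases "i = 0")
    case True
    then have "a > 0" "b > 0" using p(1) m by auto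
    then show ?thesis using calculation by linarith
  next
    case False
    then show ?thesis using calculation by linarith
  qed
  ultimately have "a \<in> {0..n - 1} \<and> b \<in> {0..n - 1} \<and> i \<in> {0..CARD('d)} \<and> a + b = n - i" by auto
  then show "m \<in> ?R" unfolding m by blast
next
  fix m assume "m \<in> ?R"
  then obtain a b i where m: "m = a * b + i" "a \<le> n - 1" "b \<le> n - 1" "i \<le> CARD('d)" "a + b = n - i"
    by auto
  have sum: "a + b + i = n" using m size by simp
  have pos: "a \<ge> 1 \<and> b \<ge> 1" if "i = 0" using that sum m size by auto
  from sign_pattern_realizable[OF sum m(4) pos] obtain p where p: "1 \<le> degree p" "degree p \<le> CARD('d)"
    "card {j \<in> {1..n}. poly p (t j) = 0} = i"
    "card {j \<in> {1..n}. poly p (t j) > 0} = b" "card {j \<in> {1..n}. poly p (t j) < 0} = a" .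
  have "slice_number p = m"
    unfolding slice_number_neighborly[OF d4] p(3-5) m(1) by simp
  moreover have "m > 0" using pos m(1) by (cases "i = 0") auto
  ultimately show "m \<in> vertex_slice_sequence P"
    unfolding vertex_slice_sequence_eq using p(1,2) by blast
qed

end

theorem theorem2p3:
  fixes n :: nat and t :: "nat \<Rightarrow> real"
  assumes "CARD('d::{finite,linorder}) \<ge> 3"
    and "n \<ge> CARD('d) + 1"
    and "strict_mono_on {1..n} t"
  shows "vertex_slice_sequence (cyclic_polytope n t :: (real ^ ('d::{finite,linorder})) set) =
    (if CARD('d) = 3 then {1..2 * (n - 2)}
     else {a * b + i | a b i. a \<in> {0..n - 1} \<and> b \<in> {0..n - 1} \<and> i \<in> {0..CARD('d)}
                              \<and> a + b = n - i})"
proof -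
  interpret cyclic n t "\<lambda>j. moment_curve (t j) :: real ^ 'd::{finite,linorder}"
    by unfold_locales (rule assms refl)+
  show ?thesis
  proof (cases "CARD('d) = 3")
    case True
    then show ?thesis using vertex_slice_sequence_dim3 by simp
  next
    case False
    then have "CARD('d) \<ge> 4" using assms(1) by simp
    then show ?thesis using vertex_slice_sequence_neighborly False by simp
  qed
qed

end
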